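(* Let $J$ be a bounded Jacobi matrix with parameters $a_n>0$, $b_n\in\mathbb{R}$. Suppose $$\sum_{n=1}^\infty(a_n-1)^2+\sum_{n=1}^\infty b_n^2<\infty$$ and that either $$\limsup_{n\to\infty}\Bigl(-\sum_{j=1}^n\bigl(a_j-1+\tfrac12b_j\bigr)\Bigr)=\infty\quad\text{or}\quad \limsup_{n\to\infty}\Bigl(-\sum_{j=1}^n\bigl(a_j-1-\tfrac12b_j\bigr)\Bigr)=\infty .$$ Then $Z(J)=\infty$.
   Context: A bounded Jacobi matrix $J$ with parameters $a_n>0$, $b_n\in\mathbb{R}$ ($n\ge1$) is the bounded self-adjoint operator on $\ell^2(\mathbb{Z}^+)$, $\mathbb{Z}^+=\{1,2,\dots\}$, given by the tridiagonal matrix with $J_{n,n}=b_n$, $J_{n,n+1}=J_{n+1,n}=a_n$. Let $\nu$ be the spectral measure of $J$ for the vector $\delta_1$, and $d\nu_{\mathrm{ac}}/dE$ the density of its absolutely continuous part. The Szegő integral is $$Z(J)=\frac1{2\pi}\int_{-2}^2\ln\left(\frac{\sqrt{4-E^2}}{2\pi\, d\nu_{\mathrm{ac}}/dE}\right)\frac{dE}{\sqrt{4-E^2}}\in(-\infty,+\infty].$$ *)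

theory Defs
  imports "HOL-Analysis.Analysis" "HOL-Computational_Algebra.Polynomial"
begin

text \<open>
  The square-summable sequences indexed by the positive integers, as functions on \<^typ>\<open>nat\<close>
  whose entry at the dummy index 0 vanishes.
\<close>

typedef ell2 = "{x :: nat \<Rightarrow> complex. x 0 = 0 \<and> summable (\<lambda>n. (cmod (x n))\<^sup>2)}"
  morphisms ell2_coord Abs_ell2
  by (rule exI[of _ "\<lambda>_. 0"]) simp

setup_lifting type_definition_ell2

lemma ell2_mult_summable:
  fixes x y :: "nat \<Rightarrow> complex"
  assumes "summable (\<lambda>n. (cmod (x n))\<^sup>2)" "summable (\<lambda>n. (cmod (y n))\<^sup>2)"
  shows "summable (\<lambda>n. cmod (x n) * cmod (y n))"
proof (rule summable_comparison_test')
  show "summable (\<lambda>n. (cmod (x n))\<^sup>2 + (cmod (y n))\<^sup>2)"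
    using assms by (rule summable_add)
  show "norm (cmod (x n) * cmod (y n)) \<le> (cmod (x n))\<^sup>2 + (cmod (y n))\<^sup>2" for n
  proof -
    have "2 * (cmod (x n) * cmod (y n)) \<le> (cmod (x n))\<^sup>2 + (cmod (y n))\<^sup>2"
      using sum_squares_bound[of "cmod (x n)" "cmod (y n)"] by (simp add: mult.assoc)
    moreover have "0 \<le> cmod (x n) * cmod (y n)" by simp
    ultimately show ?thesis unfolding real_norm_def by linarith
  qed
qed

lemma ell2_add_summable:
  fixes x y :: "nat \<Rightarrow> complex"
  assumes "summable (\<lambda>n. (cmod (x n))\<^sup>2)" "summable (\<lambda>n. (cmod (y n))\<^sup>2)"
  shows "summable (\<lambda>n. (cmod (x n + y n))\<^sup>2)"
proof (rule summable_comparison_test')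
  show "summable (\<lambda>n. (cmod (x n))\<^sup>2 + (cmod (y n))\<^sup>2 + 2 * (cmod (x n) * cmod (y n)))"
    using assms ell2_mult_summable[OF assms] by (intro summable_add summable_mult)
  fix n
  have "(cmod (x n + y n))\<^sup>2 \<le> (cmod (x n) + cmod (y n))\<^sup>2"
    by (intro power_mono norm_triangle_ineq) simp
  then show "norm ((cmod (x n + y n))\<^sup>2)
      \<le> (cmod (x n))\<^sup>2 + (cmod (y n))\<^sup>2 + 2 * (cmod (x n) * cmod (y n))"
    by (simp add: power2_sum)
qed

lemma ell2_inner_summable:
  fixes x y :: "nat \<Rightarrow> complex"
  assumes "summable (\<lambda>n. (cmod (x n))\<^sup>2)" "summable (\<lambda>n. (cmod (y n))\<^sup>2)"
  shows "summable (\<lambda>n. Re (cnj (x n) * y n))"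
proof (rule summable_comparison_test'[OF ell2_mult_summable[OF assms]])
  show "norm (Re (cnj (x n) * y n)) \<le> cmod (x n) * cmod (y n)" for n
    using abs_Re_le_cmod[of "cnj (x n) * y n"] by (simp add: norm_mult)
qed

instantiation ell2 :: real_inner
begin

lift_definition zero_ell2 :: ell2 is "\<lambda>_. 0" by simp

lift_definition plus_ell2 :: "ell2 \<Rightarrow> ell2 \<Rightarrow> ell2" is "\<lambda>x y n. x n + y n"
  by (auto intro: ell2_add_summable)

lift_definition uminus_ell2 :: "ell2 \<Rightarrow> ell2" is "\<lambda>x n. - x n" by auto

lift_definition minus_ell2 :: "ell2 \<Rightarrow> ell2 \<Rightarrow> ell2" is "\<lambda>x y n. x n - y n"
proof -
  fix x y :: "nat \<Rightarrow> complex"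
  assume "x 0 = 0 \<and> summable (\<lambda>n. (cmod (x n))\<^sup>2)" "y 0 = 0 \<and> summable (\<lambda>n. (cmod (y n))\<^sup>2)"
  then show "x 0 - y 0 = 0 \<and> summable (\<lambda>n. (cmod (x n - y n))\<^sup>2)"
    using ell2_add_summable[of x "\<lambda>n. - y n"] by simp
qed

lift_definition scaleR_ell2 :: "real \<Rightarrow> ell2 \<Rightarrow> ell2" is "\<lambda>r x n. r *\<^sub>R x n"
  by (auto simp: power_mult_distrib intro: summable_mult)

text \<open>
  The real part of the complex inner product (antilinear in the first argument); it induces the
  usual norm.
\<close>

lift_definition inner_ell2 :: "ell2 \<Rightarrow> ell2 \<Rightarrow> real" is "\<lambda>x y. \<Sum>n. Re (cnj (x n) * y n)" .

definition norm_ell2 :: "ell2 \<Rightarrow> real" where "norm_ell2 x = sqrt (inner x x)"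
definition dist_ell2 :: "ell2 \<Rightarrow> ell2 \<Rightarrow> real" where "dist_ell2 x y = norm (x - y)"
definition sgn_ell2 :: "ell2 \<Rightarrow> ell2" where "sgn_ell2 x = inverse (norm x) *\<^sub>R x"
definition uniformity_ell2 :: "(ell2 \<times> ell2) filter" where
  "uniformity_ell2 = (INF e\<in>{0<..}. principal {(x, y). dist x y < e})"
definition open_ell2 :: "ell2 set \<Rightarrow> bool" where
  "open_ell2 U \<longleftrightarrow> (\<forall>x\<in>U. eventually (\<lambda>(x', y). x' = x \<longrightarrow> y \<in> U) uniformity)"

instance
proof
  fix x y z :: ell2 and r s :: real and U :: "ell2 set"
  show "x + y + z = x + (y + z)" by transfer (simp add: add.assoc)
  show "x + y = y + x" by transfer (simp add: add.commute)
  show "0 + x = x" by transfer simp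
  show "- x + x = 0" by transfer simp
  show "x - y = x + - y" by transfer simp
  show "r *\<^sub>R (x + y) = r *\<^sub>R x + r *\<^sub>R y" by transfer (simp add: scaleR_add_right)
  show "(r + s) *\<^sub>R x = r *\<^sub>R x + s *\<^sub>R x" by transfer (simp add: scaleR_add_left)
  show "r *\<^sub>R s *\<^sub>R x = (r * s) *\<^sub>R x" by transfer simp
  show "1 *\<^sub>R x = x" by transfer simp
  show "dist x y = norm (x - y)" by (rule dist_ell2_def)
  show "sgn x = inverse (norm x) *\<^sub>R x" by (rule sgn_ell2_def)
  show "uniformity = (INF e\<in>{0<..}. principal {(x, y). dist x (y :: ell2) < e})"
    by (rule uniformity_ell2_def)
  show "open U \<longleftrightarrow> (\<forall>x\<in>U. \<forall>\<^sub>F (x', y) in uniformity. x' = x \<longrightarrow> y \<in> U)"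
    by (rule open_ell2_def)
  show "inner x y = inner y x" by transfer (simp add: mult.commute)
  show "inner (x + y) z = inner x z + inner y z"
  proof transfer
    fix x y z :: "nat \<Rightarrow> complex"
    assume h: "x 0 = 0 \<and> summable (\<lambda>n. (cmod (x n))\<^sup>2)"
      "y 0 = 0 \<and> summable (\<lambda>n. (cmod (y n))\<^sup>2)"
      "z 0 = 0 \<and> summable (\<lambda>n. (cmod (z n))\<^sup>2)"
    have "(\<Sum>n. Re (cnj (x n + y n) * z n))
        = (\<Sum>n. Re (cnj (x n) * z n) + Re (cnj (y n) * z n))"
      by (intro suminf_cong) (simp add: algebra_simps)
    also have "\<dots> = (\<Sum>n. Re (cnj (x n) * z n)) + (\<Sum>n. Re (cnj (y n) * z n))"
      using h by (intro suminf_add[symmetric] ell2_inner_summable) blast+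
    finally show "(\<Sum>n. Re (cnj (x n + y n) * z n))
        = (\<Sum>n. Re (cnj (x n) * z n)) + (\<Sum>n. Re (cnj (y n) * z n))" .
  qed
  show "inner (r *\<^sub>R x) y = r * inner x y"
  proof transfer
    fix r and x y :: "nat \<Rightarrow> complex"
    assume h: "x 0 = 0 \<and> summable (\<lambda>n. (cmod (x n))\<^sup>2)"
      "y 0 = 0 \<and> summable (\<lambda>n. (cmod (y n))\<^sup>2)"
    have "(\<Sum>n. Re (cnj (r *\<^sub>R x n) * y n)) = (\<Sum>n. r * Re (cnj (x n) * y n))"
      by (intro suminf_cong) (simp add: algebra_simps)
    also have "\<dots> = r * (\<Sum>n. Re (cnj (x n) * y n))"
      using h by (intro suminf_mult ell2_inner_summable) blast+
    finally show "(\<Sum>n. Re (cnj (r *\<^sub>R x n) * y n)) = r * (\<Sum>n. Re (cnj (x n) * y n))" .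
  qed
  have sq: "Re (cnj w * w) = (cmod w)\<^sup>2" for w :: complex
    unfolding cmod_power2 by (simp add: power2_eq_square)
  show "0 \<le> inner x x" by transfer (simp only: sq, auto intro: suminf_nonneg)
  show "inner x x = 0 \<longleftrightarrow> x = 0"
  proof transfer
    fix x :: "nat \<Rightarrow> complex"
    assume "x 0 = 0 \<and> summable (\<lambda>n. (cmod (x n))\<^sup>2)"
    then have "(\<Sum>n. (cmod (x n))\<^sup>2) = 0 \<longleftrightarrow> (\<forall>n. (cmod (x n))\<^sup>2 = 0)"
      by (intro suminf_eq_zero_iff) auto
    then show "(\<Sum>n. Re (cnj (x n) * x n)) = 0 \<longleftrightarrow> x = (\<lambda>_. 0)"
      unfolding sq by (simp add: fun_eq_iff)
  qed
  show "norm x = sqrt (inner x x)" by (rule norm_ell2_def)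
qed

end

lift_definition ell2_delta :: "nat \<Rightarrow> ell2" is "\<lambda>k n. if n = k \<and> k \<noteq> 0 then 1 else 0"
proof (intro CollectI conjI)
  fix k :: nat
  show "summable (\<lambda>n. (cmod (if n = k \<and> k \<noteq> 0 then 1 else 0))\<^sup>2)"
    by (rule summable_finite[of "{k}"]) auto
qed auto

definition jacobi_entry :: "(nat \<Rightarrow> real) \<Rightarrow> (nat \<Rightarrow> real) \<Rightarrow> nat \<Rightarrow> nat \<Rightarrow> real" where
  "jacobi_entry a b m n =
     (if m = n then b n else if n = Suc m then a m else if m = Suc n then a n else 0)"

text \<open>
  \<open>J\<close> is the bounded operator given by the tridiagonal matrix. Operators of type
  \<open>ell2 \<Rightarrow>\<^sub>L ell2\<close> are only required to be real-linear, but the matrix action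
  makes \<open>J\<close> complex-linear. The values \<open>a 0\<close> and \<open>b 0\<close> play no role, since the
  entries of vectors at index 0 vanish.
\<close>

definition is_jacobi_operator ::
    "(nat \<Rightarrow> real) \<Rightarrow> (nat \<Rightarrow> real) \<Rightarrow> (ell2 \<Rightarrow>\<^sub>L ell2) \<Rightarrow> bool" where
  "is_jacobi_operator a b J \<longleftrightarrow>
     (\<forall>x. \<forall>m\<ge>1. (\<lambda>n. of_real (jacobi_entry a b m n) * ell2_coord x n)
        sums ell2_coord (blinfun_apply J x) m)"

definition blinfun_poly ::
    "real poly \<Rightarrow> ('h::real_normed_vector \<Rightarrow>\<^sub>L 'h) \<Rightarrow> ('h \<Rightarrow>\<^sub>L 'h)" where
  "blinfun_poly p T = (\<Sum>i\<le>degree p. coeff p i *\<^sub>R (((o\<^sub>L) T ^^ i) id_blinfun))"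

text \<open>
  Only the real points of the spectrum, which for self-adjoint operators is the whole spectrum.
  If \<open>T\<close> is complex-linear, so is the inverse \<open>S\<close>.
\<close>

definition op_spectrum :: "('h::real_normed_vector \<Rightarrow>\<^sub>L 'h) \<Rightarrow> real set" where
  "op_spectrum T = {E. \<not> (\<exists>S. S o\<^sub>L (T - E *\<^sub>R id_blinfun) = id_blinfun \<and>
                               (T - E *\<^sub>R id_blinfun) o\<^sub>L S = id_blinfun)}"

text \<open>
  The continuous functional calculus: \<open>B = f(T)\<close> for \<open>f\<close> continuous on the spectrum of a
  self-adjoint \<open>T\<close> is the norm limit of \<open>p\<^sub>n(T)\<close>, where the polynomials \<open>p\<^sub>n\<close>
  converge to \<open>f\<close> uniformly on the spectrum.
\<close>

definition is_functional_calculus ::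
    "('h::real_normed_vector \<Rightarrow>\<^sub>L 'h) \<Rightarrow> (real \<Rightarrow> real) \<Rightarrow> ('h \<Rightarrow>\<^sub>L 'h) \<Rightarrow> bool" where
  "is_functional_calculus T f B \<longleftrightarrow>
     (\<exists>p. uniform_limit (op_spectrum T) (\<lambda>n. poly (p n)) f sequentially \<and>
          (\<lambda>n. blinfun_poly (p n) T) \<longlonglongrightarrow> B)"

text \<open>
  The spectral measure of a self-adjoint \<open>T\<close> for the vector \<open>\<psi>\<close>: the measure on the spectrum
  that represents \<open>f \<mapsto> \<langle>\<psi>, f(T) \<psi>\<rangle>\<close>. On a complex Hilbert space \<^const>\<open>inner\<close>
  is the real part of the inner product, and \<open>\<langle>\<psi>, f(T) \<psi>\<rangle>\<close> is real for real \<open>f\<close>.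
\<close>

definition is_spectral_measure ::
    "('h::real_inner \<Rightarrow>\<^sub>L 'h) \<Rightarrow> 'h \<Rightarrow> real measure \<Rightarrow> bool" where
  "is_spectral_measure T \<psi> \<nu> \<longleftrightarrow>
     finite_measure \<nu> \<and> sets \<nu> = sets borel \<and> emeasure \<nu> (- op_spectrum T) = 0 \<and>
     (\<forall>f B. continuous_on (op_spectrum T) f \<longrightarrow> is_functional_calculus T f B \<longrightarrow>
        inner \<psi> (blinfun_apply B \<psi>) = (LINT E:op_spectrum T|\<nu>. f E))"

definition is_lebesgue_decomposition :: "real measure \<Rightarrow> real measure \<Rightarrow> real measure \<Rightarrow> bool" where
  "is_lebesgue_decomposition \<nu> \<nu>ac \<nu>s \<longleftrightarrow>
     sets \<nu>ac = sets borel \<and> sets \<nu>s = sets borel \<and>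
     (\<forall>A\<in>sets borel. emeasure \<nu> A = emeasure \<nu>ac A + emeasure \<nu>s A) \<and>
     absolutely_continuous lborel \<nu>ac \<and>
     (\<exists>N\<in>null_sets lborel. emeasure \<nu>s (- N) = 0)"

definition ac_part :: "real measure \<Rightarrow> real measure" where
  "ac_part \<nu> = (THE \<nu>ac. \<exists>\<nu>s. is_lebesgue_decomposition \<nu> \<nu>ac \<nu>s)"

definition ac_density :: "real measure \<Rightarrow> real \<Rightarrow> real" where
  "ac_density \<nu> E = enn2real (RN_deriv lborel (ac_part \<nu>) E)"

lemma lebesgue_decomposition_exists:
  assumes "finite_measure \<nu>" and [measurable_cong]: "sets \<nu> = sets borel"
  shows "\<exists>\<nu>ac \<nu>s. is_lebesgue_decomposition \<nu> \<nu>ac \<nu>s"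
proof -
  interpret finite_measure \<nu> by fact
  define s where "s = (SUP N\<in>null_sets lborel. emeasure \<nu> N)"
  have ne: "null_sets (lborel :: real measure) \<noteq> {}" by (auto intro: null_sets.empty_sets)
  obtain g where g: "range g \<subseteq> emeasure \<nu> ` null_sets lborel" "s = (SUP i::nat. g i)"
    using ennreal_SUP_countable_SUP[OF ne, of "emeasure \<nu>"] unfolding s_def by blast
  then have "\<forall>i. \<exists>N\<in>null_sets lborel. g i = emeasure \<nu> N" by blast
  then obtain N where N: "\<And>i. N i \<in> null_sets lborel" "\<And>i. g i = emeasure \<nu> (N i)" by metis
  define M where "M = (\<Union>i. N i)"
  have M: "M \<in> null_sets lborel" unfolding M_def using N(1) by (rule null_sets_UN)
  then have Mb [measurable]: "M \<in> sets borel" by auto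
  have Nb: "N i \<in> sets borel" for i using N(1)[of i] by auto
  have "s \<le> emeasure \<nu> M"
    unfolding g(2) N(2) M_def using Nb assms(2)
    by (intro SUP_least emeasure_mono) (auto intro: sets.countable_UN)
  moreover have le: "emeasure \<nu> B \<le> s" if "B \<in> null_sets lborel" for B
    unfolding s_def using that by (rule SUP_upper)
  ultimately have sM: "emeasure \<nu> M = s" using M by (auto intro: antisym)
  define \<nu>ac where "\<nu>ac = density \<nu> (indicator (- M))"
  define \<nu>s where "\<nu>s = density \<nu> (indicator M)"
  have sb: "space \<nu> = UNIV" using sets_eq_imp_space_eq[OF assms(2)] by simp
  have eac: "emeasure \<nu>ac A = emeasure \<nu> (A - M)" if "A \<in> sets borel" for A
  proof -
    have "emeasure \<nu>ac A = (\<integral>\<^sup>+x. indicator (- M) x * indicator A x \<partial>\<nu>)"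
      unfolding \<nu>ac_def using that assms(2) by (subst emeasure_density) auto
    also have "\<dots> = (\<integral>\<^sup>+x. indicator (A - M) x \<partial>\<nu>)"
      by (intro nn_integral_cong) (auto split: split_indicator)
    finally show ?thesis using that assms(2) by simp
  qed
  have es: "emeasure \<nu>s A = emeasure \<nu> (A \<inter> M)" if "A \<in> sets borel" for A
  proof -
    have "emeasure \<nu>s A = (\<integral>\<^sup>+x. indicator M x * indicator A x \<partial>\<nu>)"
      unfolding \<nu>s_def using that assms(2) by (subst emeasure_density) auto
    also have "\<dots> = (\<integral>\<^sup>+x. indicator (A \<inter> M) x \<partial>\<nu>)"
      by (intro nn_integral_cong) (auto split: split_indicator)
    finally show ?thesis using that assms(2) by simp
  qed
  have "is_lebesgue_decomposition \<nu> \<nu>ac \<nu>s"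
    unfolding is_lebesgue_decomposition_def
  proof (intro conjI ballI)
    show "sets \<nu>ac = sets borel" "sets \<nu>s = sets borel"
      unfolding \<nu>ac_def \<nu>s_def using assms(2) by auto
    show "emeasure \<nu> A = emeasure \<nu>ac A + emeasure \<nu>s A" if A: "A \<in> sets borel" for A
    proof -
      have "emeasure \<nu> ((A - M) \<union> (A \<inter> M)) = emeasure \<nu> (A - M) + emeasure \<nu> (A \<inter> M)"
        using A assms(2) by (intro plus_emeasure[symmetric]) auto
      moreover have "(A - M) \<union> (A \<inter> M) = A" by auto
      ultimately show ?thesis using A by (simp add: eac es)
    qed
    show "absolutely_continuous lborel \<nu>ac"
      unfolding absolutely_continuous_def
    proof
      fix A :: "real set" assume A: "A \<in> null_sets lborel"
      then have Ab: "A \<in> sets borel" by auto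
      have "emeasure \<nu> M + emeasure \<nu> (A - M) = emeasure \<nu> (M \<union> (A - M))"
        using Ab assms(2) by (intro plus_emeasure) auto
      also have "M \<union> (A - M) = M \<union> A" by auto
      also have "emeasure \<nu> (M \<union> A) \<le> emeasure \<nu> M"
        unfolding sM using M A by (intro le null_sets.Un)
      finally have "emeasure \<nu> M + emeasure \<nu> (A - M) \<le> emeasure \<nu> M + 0" by simp
      then have "emeasure \<nu> (A - M) = 0"
        using ennreal_add_left_cancel_le[of "emeasure \<nu> M" "emeasure \<nu> (A - M)" 0] by simp
      then show "A \<in> null_sets \<nu>ac"
        using Ab assms(2) by (auto simp: null_sets_def eac \<nu>ac_def[THEN arg_cong[where f=sets]])
    qed
    show "\<exists>N\<in>null_sets lborel. emeasure \<nu>s (- N) = 0"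
      using M by (intro bexI[of _ M]) (auto simp: es)
  qed
  then show ?thesis by blast
qed

lemma lebesgue_decomposition_unique:
  assumes "finite_measure \<nu>" "sets \<nu> = sets borel"
  assumes d: "is_lebesgue_decomposition \<nu> \<mu> \<sigma>" "is_lebesgue_decomposition \<nu> \<mu>' \<sigma>'"
  shows "\<mu> = \<mu>'"
proof -
  obtain N N' where N: "N \<in> null_sets lborel" "emeasure \<sigma> (- N) = 0"
      "N' \<in> null_sets lborel" "emeasure \<sigma>' (- N') = 0"
    using d unfolding is_lebesgue_decomposition_def by blast
  define M where "M = N \<union> N'"
  have M: "M \<in> null_sets lborel" unfolding M_def using N by auto
  have *: "emeasure \<alpha> A = emeasure \<nu> (A - M)"
    if dec: "is_lebesgue_decomposition \<nu> \<alpha> \<beta>" and A: "A \<in> sets borel"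
      and K: "K \<in> null_sets lborel" "emeasure \<beta> (- K) = 0" "K \<subseteq> M" for \<alpha> \<beta> A K
  proof -
    have sets: "sets \<alpha> = sets borel" "sets \<beta> = sets borel" and "M \<in> null_sets \<alpha>"
      using dec M unfolding is_lebesgue_decomposition_def absolutely_continuous_def by auto
    then have "emeasure \<alpha> (A - M) = emeasure \<alpha> A"
      using A by (intro emeasure_Diff_null_set) auto
    moreover have "emeasure \<beta> (A - M) \<le> emeasure \<beta> (- K)"
      using K A M sets by (intro emeasure_mono) auto
    moreover have "A - M \<in> sets borel" using A M by auto
    then have "emeasure \<nu> (A - M) = emeasure \<alpha> (A - M) + emeasure \<beta> (A - M)"
      using dec unfolding is_lebesgue_decomposition_def by simp
    ultimately show ?thesis using K by simp
  qed
  show ?thesis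
  proof (rule measure_eqI)
    show "sets \<mu> = sets \<mu>'" using d unfolding is_lebesgue_decomposition_def by simp
    show "emeasure \<mu> A = emeasure \<mu>' A" if "A \<in> sets \<mu>" for A
    proof -
      have "A \<in> sets borel" using that d unfolding is_lebesgue_decomposition_def by simp
      then show ?thesis
        using *[OF d(1) _ N(1,2)] *[OF d(2) _ N(3,4)] by (simp add: M_def)
    qed
  qed
qed

lemma ac_part_decomposition:
  assumes "finite_measure \<nu>" "sets \<nu> = sets borel"
  shows "\<exists>\<nu>s. is_lebesgue_decomposition \<nu> (ac_part \<nu>) \<nu>s"
  unfolding ac_part_def
  using lebesgue_decomposition_exists[OF assms] lebesgue_decomposition_unique[OF assms]
  by (intro theI'[of "\<lambda>\<nu>ac. \<exists>\<nu>s. is_lebesgue_decomposition \<nu> \<nu>ac \<nu>s"]) blast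

text \<open>
  Where the density vanishes the integrand is \<open>+\<infinity>\<close>, whereas total division in HOL would
  give the value 0.
\<close>

definition szego_integrand :: "real measure \<Rightarrow> real \<Rightarrow> ereal" where
  "szego_integrand \<nu> E =
     (if ac_density \<nu> E = 0 then \<infinity>
      else ereal (ln (sqrt (4 - E\<^sup>2) / (2 * pi * ac_density \<nu> E)) / sqrt (4 - E\<^sup>2)))"

text \<open>
  The difference of the integrals of the positive and the negative part of the integrand; the latter
  integral is finite by the lemma below, so that \<open>\<infinity> - \<infinity>\<close> does not occur.
\<close>

definition szego_integral :: "real measure \<Rightarrow> ereal" where
  "szego_integral \<nu> = ereal (1 / (2 * pi)) *
     (enn2ereal (\<integral>\<^sup>+E\<in>{-2<..<2}. e2ennreal (szego_integrand \<nu> E) \<partial>lborel) -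
      enn2ereal (\<integral>\<^sup>+E\<in>{-2<..<2}. e2ennreal (- szego_integrand \<nu> E) \<partial>lborel))"

lemma szego_integrand_negative_part_finite:
  assumes "finite_measure \<nu>" "sets \<nu> = sets borel"
  shows "(\<integral>\<^sup>+E\<in>{-2<..<2}. e2ennreal (- szego_integrand \<nu> E) \<partial>lborel) < \<infinity>"
proof -
  interpret finite_measure \<nu> by fact
  define f where "f = ac_density \<nu>"
  define g where "g = RN_deriv lborel (ac_part \<nu>)"
  define h where "h = (\<lambda>x::real. indicator {0..4} x * (x powr (-3/4)))"
  have g [measurable]: "g \<in> borel_measurable borel" unfolding g_def by simp
  have f_eq: "f = (\<lambda>E. enn2real (g E))" unfolding f_def g_def ac_density_def by auto
  have f [measurable]: "f \<in> borel_measurable borel" unfolding f_eq by measurable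
  have f0: "f E \<ge> 0" for E unfolding f_eq by simp
  have h [measurable]: "h \<in> borel_measurable borel" unfolding h_def by measurable
  have h0: "h E \<ge> 0" for E unfolding h_def by simp
  obtain \<nu>s where dec: "is_lebesgue_decomposition \<nu> (ac_part \<nu>) \<nu>s"
    using ac_part_decomposition[OF assms] by blast
  have "density lborel g = ac_part \<nu>"
    unfolding g_def using dec unfolding is_lebesgue_decomposition_def
    by (intro sigma_finite_measure.density_RN_deriv) (auto intro: sigma_finite_lborel)
  then have "(\<integral>\<^sup>+E. g E \<partial>lborel) = emeasure (ac_part \<nu>) UNIV"
    using emeasure_density[of g lborel UNIV] by simp
  also have "\<dots> \<le> emeasure \<nu> UNIV"
    using dec unfolding is_lebesgue_decomposition_def by simp
  also have "\<dots> < \<infinity>" unfolding infinity_ennreal_def less_top[symmetric] by (rule emeasure_finite)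
  finally have g_fin: "(\<integral>\<^sup>+E. g E \<partial>lborel) < \<infinity>" .
  have "(\<integral>\<^sup>+E. ennreal (f E) \<partial>lborel) \<le> (\<integral>\<^sup>+E. g E \<partial>lborel)"
    unfolding f_eq by (intro nn_integral_mono) (auto simp: ennreal_enn2real_if)
  then have f_fin: "(\<integral>\<^sup>+E. ennreal (f E) \<partial>lborel) < \<infinity>" using g_fin by (rule le_less_trans)
  have "((\<lambda>x::real. x powr (-3/4)) has_integral (4 powr (-3/4 + 1) / (-3/4 + 1))) {0..4}"
    by (rule has_integral_powr_from_0) auto
  then have h_eq: "(\<integral>\<^sup>+x. ennreal (h x) \<partial>lborel) = ennreal (4 powr (-3/4 + 1) / (-3/4 + 1))"
    unfolding h_def by (intro nn_integral_has_integral_lebesgue) auto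
  then have h_fin: "(\<integral>\<^sup>+x. ennreal (h x) \<partial>lborel) < \<infinity>" by simp
  have h1: "(\<integral>\<^sup>+x. ennreal (h (2 + x)) \<partial>lborel) < \<infinity>"
    using nn_integral_real_affine[of "\<lambda>x. ennreal (h x)" 1 2] h_fin by simp
  have h2: "(\<integral>\<^sup>+x. ennreal (h (2 - x)) \<partial>lborel) < \<infinity>"
    using nn_integral_real_affine[of "\<lambda>x. ennreal (h x)" "-1" 2] h_fin by simp
  have bound: "e2ennreal (- szego_integrand \<nu> E) * indicator {-2<..<2} E
      \<le> ennreal (2 * pi) * ennreal (f E) + ennreal 4 * (ennreal (h (2 + E)) + ennreal (h (2 - E)))"
    for E
  proof (cases "E \<in> {-2<..<2} \<and> f E \<noteq> 0")
    case False
    then show ?thesis by (auto simp: szego_integrand_def f_def[symmetric] e2ennreal_neg)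
  next
    case True
    then have E: "-2 < E" "E < 2" and fp: "f E > 0" using f0[of E] by auto
    define v where "v = 4 - E\<^sup>2"
    define w where "w = sqrt v"
    have v_eq: "v = (2 - E) * (2 + E)" unfolding v_def by (simp add: power2_eq_square algebra_simps)
    then have v: "v > 0" using E by simp
    then have w: "w > 0" unfolding w_def by simp
    have "- ln (w / (2 * pi * f E)) = ln (2 * pi * f E * w) + 4 * ln (w powr (-1/2))"
      using w fp by (simp add: ln_div ln_mult ln_powr)
    also have "\<dots> \<le> 2 * pi * f E * w + 4 * w powr (-1/2)"
      using w fp by (intro add_mono mult_left_mono ln_bound) auto
    finally have "- ln (w / (2 * pi * f E)) / w \<le> (2 * pi * f E * w + 4 * w powr (-1/2)) / w"
      using w by (intro divide_right_mono) auto
    also have "\<dots> = 2 * pi * f E + 4 * (w powr (-1/2) / w)"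
      using w by (simp add: field_simps)
    also have "w powr (-1/2) / w = v powr (-3/4)"
    proof -
      have "w = v powr (1/2)" unfolding w_def using v by (simp add: powr_half_sqrt)
      then have "w powr (-1/2) / w = v powr (-1/4) / v powr (1/2)" by (simp add: powr_powr)
      also have "\<dots> = v powr (-1/4 - 1/2)" by (rule powr_diff[symmetric])
      finally show ?thesis by simp
    qed
    also have "v powr (-3/4) \<le> h (2 + E) + h (2 - E)"
    proof (cases "E \<ge> 0")
      case True
      then have "1 * (2 - E) \<le> (2 + E) * (2 - E)" using E by (intro mult_right_mono) auto
      then have "v powr (-3/4) \<le> (2 - E) powr (-3/4)"
        using E by (intro powr_mono2') (auto simp: v_eq mult.commute)
      also have "\<dots> = h (2 - E)" using E by (simp add: h_def)
      finally show ?thesis using h0[of "2 + E"] by linarith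
    next
      case False
      then have "1 * (2 + E) \<le> (2 - E) * (2 + E)" using E by (intro mult_right_mono) auto
      then have "v powr (-3/4) \<le> (2 + E) powr (-3/4)"
        using E by (intro powr_mono2') (auto simp: v_eq)
      also have "\<dots> = h (2 + E)" using E by (simp add: h_def)
      finally show ?thesis using h0[of "2 - E"] by linarith
    qed
    finally have *: "- ln (w / (2 * pi * f E)) / w \<le> 2 * pi * f E + 4 * (h (2 + E) + h (2 - E))"
      by simp
    have "e2ennreal (- szego_integrand \<nu> E) = ennreal (- ln (w / (2 * pi * f E)) / w)"
      using fp by (simp add: szego_integrand_def f_def[symmetric] w_def v_def flip: ennreal.abs_eq)
    also have "\<dots> \<le> ennreal (2 * pi * f E + 4 * (h (2 + E) + h (2 - E)))"
      by (rule ennreal_leI) (rule *)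
    also have "\<dots> = ennreal (2 * pi) * ennreal (f E)
        + ennreal 4 * (ennreal (h (2 + E)) + ennreal (h (2 - E)))"
      using f0[of E] h0[of "2 + E"] h0[of "2 - E"]
      by (simp add: ennreal_plus ennreal_mult distrib_left del: ennreal_numeral)
    finally show ?thesis using E by simp
  qed
  have "(\<integral>\<^sup>+E\<in>{-2<..<2}. e2ennreal (- szego_integrand \<nu> E) \<partial>lborel)
      \<le> (\<integral>\<^sup>+E. ennreal (2 * pi) * ennreal (f E)
          + ennreal 4 * (ennreal (h (2 + E)) + ennreal (h (2 - E))) \<partial>lborel)"
    by (intro nn_integral_mono bound)
  also have "\<dots> = ennreal (2 * pi) * (\<integral>\<^sup>+E. ennreal (f E) \<partial>lborel)
      + ennreal 4 * ((\<integral>\<^sup>+E. ennreal (h (2 + E)) \<partial>lborel) + (\<integral>\<^sup>+E. ennreal (h (2 - E)) \<partial>lborel))"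
    by (simp add: nn_integral_add nn_integral_cmult del: ennreal_numeral)
  also have "\<dots> < \<infinity>"
    using f_fin h1 h2 by (simp add: ennreal_mult_less_top del: ennreal_numeral)
  finally show ?thesis .
qed

end

theory Submission
  imports Defs "HOL-Computational_Algebra.Fundamental_Theorem_Algebra" "HOL-Real_Asymp.Real_Asymp"
begin

text \<open>
  Assume \<open>Z(J) < \<infinity>\<close> and let \<open>s = \<plusminus>1\<close>. The monic orthogonal polynomial
  \<open>P\<^sub>n\<close> has square norm \<open>(a\<^sub>1 \<cdots> a\<^sub>n)\<^sup>2\<close> in \<open>L\<^sup>2(\<nu>)\<close>, so by Jensen's inequality the integral of
  \<open>ln P\<^sub>n\<^sup>2\<close> against \<open>(2 + s E)\<^sup>2 / 8\<close> times the arcsine law is at most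
  \<open>(3/2) \<Sum> ln a\<^sub>j\<close> plus a constant. On the other hand the logarithmic potential of this weight at a
  real point \<open>x\<close> is at least \<open>- s x / 2 - (x\<^sup>2 - 2) / 16\<close>, with equality on \<open>[-2, 2]\<close>; outside, for
  \<open>|x| = 2 cosh t\<close>, the difference is \<open>3t/4 \<plusminus> sinh t + sinh(2t)/8\<close>, with derivative
  \<open>(1 \<plusminus> cosh t)\<^sup>2 / 2 \<ge> 0\<close>. So no bound on the eigenvalues outside \<open>[-2, 2]\<close> is needed, and summing over
  the roots of \<open>P\<^sub>n\<close>, whose power sums are traces of the truncated matrix, bounds
  \<open>\<Sum> (a\<^sub>j - 1 + s b\<^sub>j / 2)\<close> from below.
\<close>

section \<open>Polynomials of a bounded operator\<close>

text \<open>Coefficients above the degree vanish. A common summation bound lets polynomials of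
  different degrees be added coefficientwise.\<close>

lemma blinfun_poly_eq_sum:
  assumes "degree p \<le> N"
  shows "blinfun_poly p T = (\<Sum>i\<le>N. coeff p i *\<^sub>R (((o\<^sub>L) T ^^ i) id_blinfun))"
  unfolding blinfun_poly_def
  using assms by (intro sum.mono_neutral_left) (auto simp: coeff_eq_0 not_le)

lemma blinfun_poly_0 [simp]: "blinfun_poly 0 T = 0"
  by (simp add: blinfun_poly_def)

lemma blinfun_poly_add: "blinfun_poly (p + q) T = blinfun_poly p T + blinfun_poly q T"
  by (simp add: blinfun_poly_eq_sum[of _ "max (degree p) (degree q)"] degree_add_le
      scaleR_add_left sum.distrib)

lemma blinfun_poly_smult: "blinfun_poly (smult c p) T = c *\<^sub>R blinfun_poly p T"
  by (simp add: blinfun_poly_eq_sum[of _ "degree p"] degree_smult_le scaleR_sum_right)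

lemma blinfun_poly_pCons:
  "blinfun_poly (pCons c p) T = c *\<^sub>R id_blinfun + (T o\<^sub>L blinfun_poly p T)"
proof -
  have "blinfun_poly (pCons c p) T
      = (\<Sum>i\<le>Suc (degree p). coeff (pCons c p) i *\<^sub>R (((o\<^sub>L) T ^^ i) id_blinfun))"
    by (intro blinfun_poly_eq_sum degree_pCons_le)
  also have "\<dots> = c *\<^sub>R id_blinfun
      + (\<Sum>i\<le>degree p. coeff p i *\<^sub>R (T o\<^sub>L (((o\<^sub>L) T ^^ i) id_blinfun)))"
    by (subst sum.atMost_Suc_shift) simp
  also have "(\<Sum>i\<le>degree p. coeff p i *\<^sub>R (T o\<^sub>L (((o\<^sub>L) T ^^ i) id_blinfun)))
      = T o\<^sub>L blinfun_poly p T"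
    by (rule blinfun_eqI) (simp add: blinfun_poly_def blinfun.sum_left blinfun.sum_right
        blinfun.scaleR_left blinfun.scaleR_right)
  finally show ?thesis .
qed

text \<open>Horner's scheme: induction on \<open>p\<close>, peeling off one factor \<open>T\<close>
  at a time with the rule for \<open>pCons\<close>.\<close>

lemma blinfun_poly_mult: "blinfun_poly (p * q) T = blinfun_poly p T o\<^sub>L blinfun_poly q T"
  by (induction p)
    (auto intro!: blinfun_eqI
      simp: blinfun_poly_add blinfun_poly_smult blinfun_poly_pCons blinfun.bilinear_simps)

lemma blinfun_poly_1 [simp]: "blinfun_poly 1 T = id_blinfun"
  by (simp add: one_pCons blinfun_poly_pCons blinfun_eqI)

section \<open>Orthogonal polynomials of a Jacobi matrix\<close>

text \<open>These are the characteristic polynomials of the upper left blocks of the Jacobi matrix,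
  and the monic orthogonal polynomials of \<nu>. The field is left open so that the roots can be
  located over the complex numbers and then used over the reals.\<close>

fun jacobi_poly :: "(nat \<Rightarrow> real) \<Rightarrow> (nat \<Rightarrow> real) \<Rightarrow> nat \<Rightarrow> 'a::real_field poly" where
  "jacobi_poly a b 0 = 1"
| "jacobi_poly a b (Suc 0) = [:- of_real (b 1), 1:]"
| "jacobi_poly a b (Suc (Suc n)) = [:- of_real (b (Suc (Suc n))), 1:] * jacobi_poly a b (Suc n)
     - smult (of_real ((a (Suc n))\<^sup>2)) (jacobi_poly a b n)"

lemma poly_jacobi_poly_of_real:
  "poly (jacobi_poly a b n) (of_real x) = (of_real (poly (jacobi_poly a b n) x) :: 'a::real_field)"
  by (induction a b n rule: jacobi_poly.induct) (auto simp: algebra_simps)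

section \<open>Leading coefficients and power sums of the roots\<close>

text \<open>Three leading coefficients; the factor \<open>x\<^sup>2\<close> gives the missing ones the value 0
  if \<open>n < 2\<close>.\<close>

definition monic_power_sums :: "'a::real_field poly \<Rightarrow> nat \<Rightarrow> 'a \<Rightarrow> 'a \<Rightarrow> bool" where
  "monic_power_sums p n s1 s2 \<longleftrightarrow>
     (\<forall>m>n + 2. coeff ([:0, 0, 1:] * p) m = 0) \<and> coeff ([:0, 0, 1:] * p) (n + 2) = 1 \<and>
     coeff ([:0, 0, 1:] * p) (n + 1) = - s1 \<and> 2 * coeff ([:0, 0, 1:] * p) n = s1\<^sup>2 - s2"

lemma monic_power_sums_1: "monic_power_sums 1 0 0 0"
  by (auto simp: monic_power_sums_def coeff_pCons split: nat.splits)

text \<open>Newton's identities for one more root \<open>x\<close>: the second elementary symmetric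
  function is half of \<open>s1^2 - s2\<close>. The power sums are read off the coefficients, so
  they make sense in any real field.\<close>

lemma monic_power_sums_linear_mult:
  assumes "monic_power_sums p n s1 s2"
  shows "monic_power_sums ([:- x, 1:] * p) (Suc n) (s1 + x) (s2 + x\<^sup>2)"
proof -
  define R where "R = [:0, 0, 1:] * p"
  have R: "\<forall>m>n + 2. coeff R m = 0" "coeff R (n + 2) = 1" "coeff R (n + 1) = - s1"
      "2 * coeff R n = s1\<^sup>2 - s2"
    using assms unfolding monic_power_sums_def R_def by blast+
  have coeff_eq: "coeff ([:0, 0, 1:] * ([:- x, 1:] * p)) (Suc k) = coeff R k - x * coeff R (Suc k)" for k
  proof -
    have "[:0, 0, 1:] * ([:- x, 1:] * p) = [:- x, 1:] * R"
      unfolding R_def by (simp only: mult.left_commute)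
    moreover have "coeff ([:- x, 1:] * R) (Suc k) = coeff R k - x * coeff R (Suc k)" for R
      by simp
    ultimately show ?thesis by (simp only:)
  qed
  show ?thesis
    unfolding monic_power_sums_def
  proof (intro conjI allI impI)
    fix m :: nat assume "m > Suc n + 2"
    then obtain k where "m = Suc k" "k > n + 2" by (cases m) auto
    then show "coeff ([:0, 0, 1:] * ([:- x, 1:] * p)) m = 0"
      using R(1) by (simp add: coeff_eq del: mult_pCons_left)
  next
    show "coeff ([:0, 0, 1:] * ([:- x, 1:] * p)) (Suc n + 2) = 1"
      using R(1,2) by (simp add: coeff_eq del: mult_pCons_left)
    show "coeff ([:0, 0, 1:] * ([:- x, 1:] * p)) (Suc n + 1) = - (s1 + x)"
      using R(2,3) by (simp add: coeff_eq del: mult_pCons_left)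
    have "2 * (coeff R n - x * coeff R (Suc n)) = 2 * coeff R n - 2 * x * coeff R (n + 1)"
      by (simp add: algebra_simps)
    also have "\<dots> = (s1 + x)\<^sup>2 - (s2 + x\<^sup>2)"
      unfolding R by (simp add: algebra_simps power2_eq_square)
    finally show "2 * coeff ([:0, 0, 1:] * ([:- x, 1:] * p)) (Suc n) = (s1 + x)\<^sup>2 - (s2 + x\<^sup>2)"
      by (simp only: coeff_eq)
  qed
qed

text \<open>The degree of \<open>q\<close> is lower by two, so only the third leading coefficient
  changes, by \<open>- c\<close>; it contains \<open>- s2 / 2\<close>.\<close>

lemma monic_power_sums_diff_smult:
  assumes "monic_power_sums p (Suc (Suc n)) s1 s2" "monic_power_sums q n t1 t2"
  shows "monic_power_sums (p - smult c q) (Suc (Suc n)) s1 (s2 + 2 * c)"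
  using assms
  by (auto simp: monic_power_sums_def right_diff_distrib diff_diff_eq
      simp del: mult_pCons_left)

lemma monic_power_sums_prod:
  "monic_power_sums (\<Prod>j<n. [:- x j, 1:]) n (\<Sum>j<n. x j) (\<Sum>j<n. (x j)\<^sup>2)"
proof (induction n)
  case 0
  then show ?case by (simp add: monic_power_sums_1)
next
  case (Suc n)
  then show ?case using monic_power_sums_linear_mult[OF Suc, of "x n"] by (simp add: mult.commute)
qed

text \<open>The two values are the traces of the truncated matrix and of its square, obtained here
  from the three-term recursion alone. The condition \<open>j < n\<close> occurs because
  \<open>a n\<close> couples index \<open>n\<close> to \<open>n + 1\<close>, outside the
  block.\<close>

lemma monic_power_sums_jacobi_poly:
  "monic_power_sums (jacobi_poly a b n :: 'a::real_field poly) n (\<Sum>j=1..n. of_real (b j))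
     (\<Sum>j=1..n. (of_real (b j))\<^sup>2 + 2 * (if j < n then (of_real (a j))\<^sup>2 else 0))"
proof (induction a b n rule: jacobi_poly.induct)
  case (1 a b)
  then show ?case by (simp add: monic_power_sums_1)
next
  case (2 a b)
  then show ?case
    using monic_power_sums_linear_mult[OF monic_power_sums_1, of "of_real (b 1)"] by simp
next
  case (3 a b n)
  have eq: "(\<Sum>j=1..Suc (Suc n). (of_real (b j) :: 'a)\<^sup>2 + 2 * (if j < Suc (Suc n) then (of_real (a j))\<^sup>2 else 0))
    = (\<Sum>j=1..Suc n. (of_real (b j))\<^sup>2 + 2 * (if j < Suc n then (of_real (a j))\<^sup>2 else 0))
      + (of_real (b (Suc (Suc n))))\<^sup>2 + 2 * of_real ((a (Suc n))\<^sup>2)"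
  proof -
    have "(\<Sum>j=1..n. (of_real (b j) :: 'a)\<^sup>2 + 2 * (if j < Suc (Suc n) then (of_real (a j))\<^sup>2 else 0))
      = (\<Sum>j=1..n. (of_real (b j))\<^sup>2 + 2 * (if j < Suc n then (of_real (a j))\<^sup>2 else 0))"
      by (intro sum.cong) auto
    then show ?thesis by (simp add: algebra_simps)
  qed
  show ?case
    using monic_power_sums_diff_smult[OF monic_power_sums_linear_mult[OF "3.IH"(1),
          of "of_real (b (Suc (Suc n)))"] "3.IH"(2), of "of_real ((a (Suc n))\<^sup>2)"]
    unfolding eq jacobi_poly.simps by simp
qed

lemma monic_power_sums_unique:
  assumes "monic_power_sums p n s1 s2" "monic_power_sums p n t1 t2"
  shows "s1 = t1" "s2 = t2"
  using assms unfolding monic_power_sums_def by auto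

lemma monic_power_sums_degree:
  assumes "monic_power_sums p n s1 s2"
  shows "degree p = n" "lead_coeff p = 1"
proof -
  have *: "coeff ([:0, 0, 1:] * p) (m + 2) = coeff p m" for m by simp
  have 1: "coeff p n = 1" using assms *[of n] unfolding monic_power_sums_def by metis
  have "coeff p m = 0" if "m > n" for m
    using that assms *[of m] unfolding monic_power_sums_def by (metis add_less_cancel_right)
  then have "degree p \<le> n" by (intro degree_le) auto
  then show d: "degree p = n" using 1 le_degree[of p n] by simp
  show "lead_coeff p = 1" using 1 d by simp
qed

section \<open>Real roots\<close>

text \<open>\<open>Im (P\<^sub>n\<^sub>+\<^sub>1 cnj P\<^sub>n) = Im \<lambda> |P\<^sub>n|\<^sup>2 + a\<^sub>n\<^sup>2 Im (P\<^sub>n cnj P\<^sub>n\<^sub>-\<^sub>1)\<close> off the real axis has the sign of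
  \<open>Im \<lambda>\<close>, hence all roots are real.\<close>

lemma jacobi_poly_complex_nonzero:
  assumes "Im z > 0"
  shows "poly (jacobi_poly a b n) z \<noteq> 0 \<and>
    Im (poly (jacobi_poly a b (Suc n)) z * cnj (poly (jacobi_poly a b n) z)) > 0"
proof (induction n)
  case 0
  then show ?case using assms by simp
next
  case (Suc n)
  define p q where "p = poly (jacobi_poly a b (Suc n)) z" and "q = poly (jacobi_poly a b n) z"
  have h: "Im (p * cnj q) > 0" using Suc unfolding p_def q_def by simp
  then have p: "p \<noteq> 0" by auto
  have "poly (jacobi_poly a b (Suc (Suc n))) z * cnj p
      = (z - of_real (b (Suc (Suc n)))) * (p * cnj p) - of_real ((a (Suc n))\<^sup>2) * (q * cnj p)"
    unfolding p_def q_def by (simp add: algebra_simps)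
  also have "\<dots> = (z - of_real (b (Suc (Suc n)))) * of_real ((cmod p)\<^sup>2)
      - of_real ((a (Suc n))\<^sup>2) * cnj (p * cnj q)"
    by (subst complex_norm_square) (simp add: mult.commute)
  also have "Im \<dots> = Im z * (cmod p)\<^sup>2 + (a (Suc n))\<^sup>2 * Im (p * cnj q)"
    by (simp add: Im_complex_of_real algebra_simps del: of_real_power)
  finally have "Im (poly (jacobi_poly a b (Suc (Suc n))) z * cnj p)
      = Im z * (cmod p)\<^sup>2 + (a (Suc n))\<^sup>2 * Im (p * cnj q)" .
  moreover have "Im z * (cmod p)\<^sup>2 > 0" using p assms by simp
  moreover have "(a (Suc n))\<^sup>2 * Im (p * cnj q) \<ge> 0" using h by simp
  ultimately show ?case using p unfolding p_def by (simp del: jacobi_poly.simps)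
qed

lemma poly_jacobi_poly_cnj:
  "poly (jacobi_poly a b n) (cnj z) = cnj (poly (jacobi_poly a b n) z)"
  by (induction a b n rule: jacobi_poly.induct) (auto simp: algebra_simps)

text \<open>The coefficients are real, so conjugation reduces the lower half plane to the upper
  one.\<close>

lemma jacobi_poly_root_real:
  assumes "poly (jacobi_poly a b n) z = 0"
  shows "Im z = 0"
proof (rule ccontr)
  assume "Im z \<noteq> 0"
  then have "Im z > 0 \<or> Im (cnj z) > 0" by auto
  then show False
    using assms jacobi_poly_complex_nonzero[of z a b n] jacobi_poly_complex_nonzero[of "cnj z" a b n]
    by (auto simp: poly_jacobi_poly_cnj)
qed

text \<open>The fundamental theorem of algebra gives complex linear factors; all roots are real, so
  the factorization descends to the reals.\<close>

lemma jacobi_poly_factorization: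
  obtains x :: "nat \<Rightarrow> real" where
    "jacobi_poly a b n = (\<Prod>j<n. [:- x j, 1:])"
    "(\<Sum>j<n. x j) = (\<Sum>j=1..n. b j)"
    "(\<Sum>j<n. (x j)\<^sup>2) = (\<Sum>j=1..n. (b j)\<^sup>2 + 2 * (if j < n then (a j)\<^sup>2 else 0))"
proof -
  let ?P = "jacobi_poly a b n :: complex poly"
  note m = monic_power_sums_degree[OF monic_power_sums_jacobi_poly[of a b n, where ?'a=complex]]
  obtain y where y: "smult (lead_coeff ?P) (\<Prod>j<degree ?P. [:- y j, 1:]) = ?P"
    by (rule complex_poly_decompose')
  have P: "?P = (\<Prod>j<n. [:- y j, 1:])" using y unfolding m(2) unfolding m(1) by simp
  define x where "x = (\<lambda>j. Re (y j))"
  have yx: "y j = of_real (x j)" if "j < n" for j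
  proof -
    have "poly ?P (y j) = 0"
      unfolding P poly_prod using that by (intro prod_zero) auto
    then have "Im (y j) = 0" by (rule jacobi_poly_root_real)
    then show ?thesis by (simp add: complex_eq_iff x_def)
  qed
  have eq: "jacobi_poly a b n = (\<Prod>j<n. [:- x j, 1:])"
  proof (rule poly_ext)
    fix t :: real
    have "complex_of_real (poly (jacobi_poly a b n) t) = poly ?P (of_real t)"
      by (simp add: poly_jacobi_poly_of_real)
    also have "\<dots> = of_real (poly (\<Prod>j<n. [:- x j, 1:]) t)"
      unfolding P poly_prod by (auto intro!: prod.cong simp: yx)
    finally show "poly (jacobi_poly a b n) t = poly (\<Prod>j<n. [:- x j, 1:]) t"
      using of_real_eq_iff by blast
  qed
  show ?thesis
  proof (rule that[OF eq])
    \<comment> \<open>Both the roots and the traces are power sums for the same leading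
      coefficients, and these determine them.\<close>
    have "monic_power_sums (jacobi_poly a b n) n (\<Sum>j<n. x j) (\<Sum>j<n. (x j)\<^sup>2)"
      unfolding eq by (rule monic_power_sums_prod)
    from monic_power_sums_unique[OF this monic_power_sums_jacobi_poly]
    show "(\<Sum>j<n. x j) = (\<Sum>j=1..n. b j)"
      "(\<Sum>j<n. (x j)\<^sup>2) = (\<Sum>j=1..n. (b j)\<^sup>2 + 2 * (if j < n then (a j)\<^sup>2 else 0))"
      by (simp_all cong: if_cong)
  qed
qed

section \<open>The spectral measure and the orthogonal polynomials\<close>

lemma ell2_inner_delta:
  assumes "m \<ge> 1"
  shows "inner (ell2_delta m) x = Re (ell2_coord x m)"
proof -
  have "inner (ell2_delta m) x = (\<Sum>n. if n = m then Re (ell2_coord x m) else 0)"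
    using assms unfolding inner_ell2.rep_eq ell2_delta.rep_eq
    by (intro suminf_cong) auto
  also have "\<dots> = Re (ell2_coord x m)"
    using suminf_finite[of "{m}" "\<lambda>n. if n = m then Re (ell2_coord x m) else 0"] by simp
  finally show ?thesis .
qed

lemma ell2_coord_0: "ell2_coord x 0 = 0"
  using ell2_coord[of x] by simp

lemma jacobi_apply_coord:
  assumes "is_jacobi_operator a b J" "m \<ge> 1"
  shows "ell2_coord (blinfun_apply J x) m = of_real (b m) * ell2_coord x m
    + of_real (a m) * ell2_coord x (Suc m) + of_real (a (m - 1)) * ell2_coord x (m - 1)"
proof -
  obtain k where k: "m = Suc k" using assms(2) by (cases m) auto
  have "(\<lambda>n. of_real (jacobi_entry a b m n) * ell2_coord x n)
      sums (\<Sum>n\<in>{k, Suc k, Suc (Suc k)}. of_real (jacobi_entry a b m n) * ell2_coord x n)"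
    by (rule sums_finite) (auto simp: jacobi_entry_def k)
  then have "ell2_coord (blinfun_apply J x) m
      = (\<Sum>n\<in>{k, Suc k, Suc (Suc k)}. of_real (jacobi_entry a b m n) * ell2_coord x n)"
    using assms unfolding is_jacobi_operator_def by (blast intro: sums_unique2)
  then show ?thesis by (simp add: jacobi_entry_def k)
qed

lemma ell2_eqI: "(\<And>n. n \<ge> 1 \<Longrightarrow> ell2_coord x n = ell2_coord y n) \<Longrightarrow> x = y"
  by (metis One_nat_def Suc_leI ell2_coord_0 ell2_coord_inject ext gr0I)

lemma ell2_delta_0 [simp]: "ell2_delta 0 = 0"
  by transfer auto

text \<open>Column \<open>m\<close> of the matrix; for \<open>m = 1\<close> the last term vanishes
  because \<open>ell2_delta 0 = 0\<close>.\<close>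

lemma jacobi_apply_delta:
  assumes "is_jacobi_operator a b J" "m \<ge> 1"
  shows "blinfun_apply J (ell2_delta m)
    = b m *\<^sub>R ell2_delta m + a m *\<^sub>R ell2_delta (Suc m) + a (m - 1) *\<^sub>R ell2_delta (m - 1)"
proof (rule ell2_eqI)
  fix n :: nat assume "n \<ge> 1"
  then show "ell2_coord (blinfun_apply J (ell2_delta m)) n = ell2_coord (b m *\<^sub>R ell2_delta m
      + a m *\<^sub>R ell2_delta (Suc m) + a (m - 1) *\<^sub>R ell2_delta (m - 1)) n"
    using assms(2) by (cases n; cases m)
      (auto simp: jacobi_apply_coord[OF assms(1)] plus_ell2.rep_eq scaleR_ell2.rep_eq
        ell2_delta.rep_eq scaleR_conv_of_real)
qed

text \<open>Symmetry of the matrix in the only form used later: \<open>J\<close> is moved to the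
  basis vector on the left.\<close>

lemma inner_delta_jacobi:
  assumes "is_jacobi_operator a b J" "m \<ge> 1"
  shows "inner (ell2_delta m) (blinfun_apply J x) = b m * inner (ell2_delta m) x
    + a m * inner (ell2_delta (Suc m)) x + a (m - 1) * inner (ell2_delta (m - 1)) x"
proof (cases "m = 1")
  case True
  then show ?thesis
    by (simp add: ell2_inner_delta jacobi_apply_coord[OF assms(1)] ell2_coord_0)
next
  case False
  with assms(2) have "m - 1 \<ge> 1" by simp
  then show ?thesis
    using assms by (simp add: ell2_inner_delta jacobi_apply_coord[OF assms(1)])
qed

text \<open>The dual of the action of \<open>jacobi_poly\<close> on the first basis vector. The
  factor \<open>J - b\<close> is split off on the right, next to \<open>x\<close>, which is why
  \<open>x\<close> is arbitrary in the induction; the square of \<open>a\<close> cancels the term at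
  the lower index.\<close>

lemma inner_delta_jacobi_poly:
  assumes "is_jacobi_operator a b J"
  shows "inner (ell2_delta 1) (blinfun_apply (blinfun_poly (jacobi_poly a b n) J) x)
    = (\<Prod>j=1..n. a j) * inner (ell2_delta (Suc n)) x"
  using assms
proof (induction a b n arbitrary: x rule: jacobi_poly.induct)
  case (1 a b)
  then show ?case by simp
next
  case (2 a b)
  then show ?case
    by (auto simp: blinfun_poly_pCons blinfun.bilinear_simps inner_simps inner_delta_jacobi)
next
  case (3 a b n)
  let ?P = "blinfun_poly (jacobi_poly a b (Suc n)) J"
  let ?b = "b (Suc (Suc n))"
  have lin: "blinfun_poly [:- ?b, 1:] J = J - ?b *\<^sub>R id_blinfun"
    by (rule blinfun_eqI) (simp add: blinfun_poly_pCons blinfun.bilinear_simps)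
  have eq: "blinfun_poly (jacobi_poly a b (Suc (Suc n)) :: real poly) J
      = (blinfun_poly (jacobi_poly a b (Suc n)) J o\<^sub>L (J - ?b *\<^sub>R id_blinfun))
        - (a (Suc n))\<^sup>2 *\<^sub>R blinfun_poly (jacobi_poly a b n) J"
  proof -
    have "jacobi_poly a b (Suc (Suc n)) = jacobi_poly a b (Suc n) * [:- ?b, 1:]
        + smult (- ((a (Suc n))\<^sup>2)) (jacobi_poly a b n)"
      by (simp only: jacobi_poly.simps of_real_eq_id id_apply smult_minus_left)
        (simp only: mult.commute diff_conv_add_uminus)
    then show ?thesis
      by (simp only: blinfun_poly_add blinfun_poly_mult blinfun_poly_smult lin) simp
  qed
  show ?case
    unfolding eq using "3.prems"
    by (simp add: blinfun.bilinear_simps inner_simps "3.IH"[unfolded One_nat_def] inner_delta_jacobi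
        algebra_simps power2_eq_square del: jacobi_poly.simps)
qed

text \<open>The same cancellation with \<open>J - b\<close> split off on the left, where it acts on
  the basis vector given by the induction hypothesis.\<close>

lemma jacobi_poly_apply_delta:
  assumes "is_jacobi_operator a b J"
  shows "blinfun_apply (blinfun_poly (jacobi_poly a b n) J) (ell2_delta 1)
    = (\<Prod>j=1..n. a j) *\<^sub>R ell2_delta (Suc n)"
  using assms
proof (induction a b n rule: jacobi_poly.induct)
  case (1 a b)
  then show ?case by simp
next
  case (2 a b)
  then show ?case
    by (simp add: blinfun_poly_pCons blinfun.bilinear_simps jacobi_apply_delta)
next
  case (3 a b n)
  let ?b = "b (Suc (Suc n))"
  have lin: "blinfun_poly [:- ?b, 1:] J = J - ?b *\<^sub>R id_blinfun"
    by (rule blinfun_eqI) (simp add: blinfun_poly_pCons blinfun.bilinear_simps)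
  have eq: "blinfun_poly (jacobi_poly a b (Suc (Suc n)) :: real poly) J
      = ((J - ?b *\<^sub>R id_blinfun) o\<^sub>L blinfun_poly (jacobi_poly a b (Suc n)) J)
        - (a (Suc n))\<^sup>2 *\<^sub>R blinfun_poly (jacobi_poly a b n) J"
  proof -
    have "jacobi_poly a b (Suc (Suc n)) = [:- ?b, 1:] * jacobi_poly a b (Suc n)
        + smult (- ((a (Suc n))\<^sup>2)) (jacobi_poly a b n)"
      by (simp only: jacobi_poly.simps of_real_eq_id id_apply smult_minus_left diff_conv_add_uminus)
    then show ?thesis
      by (simp only: blinfun_poly_add blinfun_poly_mult blinfun_poly_smult lin) simp
  qed
  show ?case
    unfolding eq using "3.prems"
    by (simp add: blinfun.bilinear_simps "3.IH"[unfolded One_nat_def] jacobi_apply_delta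
        algebra_simps power2_eq_square del: jacobi_poly.simps)
qed

text \<open>A polynomial approximates itself, so a constant sequence witnesses the functional
  calculus.\<close>

lemma spectral_measure_integral_poly:
  assumes "is_spectral_measure T \<psi> \<nu>"
  shows "(LINT E:op_spectrum T|\<nu>. poly p E) = inner \<psi> (blinfun_apply (blinfun_poly p T) \<psi>)"
proof -
  have "is_functional_calculus T (poly p) (blinfun_poly p T)"
    unfolding is_functional_calculus_def
    by (intro exI[of _ "\<lambda>_. p"]) (simp add: uniform_limit_const)
  then show ?thesis
    using assms continuous_on_poly[OF continuous_on_id, of "op_spectrum T" p]
    unfolding is_spectral_measure_def by metis
qed

text \<open>The total mass shows that the spectrum is measurable: otherwise the integral of the
  constant 1 over it would be 0. In the same way a positive value forces integrability.\<close>

lemma spectral_measure_nn_integral_poly: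
  assumes spec: "is_spectral_measure T \<psi> \<nu>" and "\<psi> \<noteq> 0"
    and nonneg: "\<And>E. poly p E \<ge> 0"
    and pos: "inner \<psi> (blinfun_apply (blinfun_poly p T) \<psi>) > 0"
  shows "(\<integral>\<^sup>+E. ennreal (poly p E) \<partial>\<nu>) = ennreal (inner \<psi> (blinfun_apply (blinfun_poly p T) \<psi>))"
proof -
  let ?S = "op_spectrum T"
  have sets: "sets \<nu> = sets borel" and null: "emeasure \<nu> (- ?S) = 0"
    using spec unfolding is_spectral_measure_def by auto
  have sp: "space \<nu> = UNIV" using sets_eq_imp_space_eq[OF sets] by simp
  have "(LINT E:?S|\<nu>. 1) = inner \<psi> \<psi>"
    using spectral_measure_integral_poly[OF spec, of 1] by simp
  then have "(LINT E|\<nu>. indicator ?S E) \<noteq> (0::real)"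
    using \<open>\<psi> \<noteq> 0\<close> by (simp add: set_lebesgue_integral_def)
  then have "integrable \<nu> (indicator ?S :: real \<Rightarrow> real)"
    using not_integrable_integral_eq by blast
  then have "(indicator ?S :: real \<Rightarrow> real) \<in> borel_measurable \<nu>" by auto
  then have S: "?S \<in> sets \<nu>" by (simp add: borel_measurable_indicator_iff sp)
  then have "- ?S \<in> sets \<nu>" using sets.compl_sets[of ?S \<nu>] by (simp add: sp Compl_eq_Diff_UNIV)
  then have "- ?S \<in> null_sets \<nu>" using null by (auto simp: null_sets_def)
  then have ae: "AE E in \<nu>. E \<in> ?S" by (rule AE_I') auto
  have eq: "(LINT E|\<nu>. indicator ?S E *\<^sub>R poly p E) = inner \<psi> (blinfun_apply (blinfun_poly p T) \<psi>)"
    using spectral_measure_integral_poly[OF spec, of p] by (simp add: set_lebesgue_integral_def)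
  then have int: "integrable \<nu> (\<lambda>E. indicator ?S E *\<^sub>R poly p E)"
    using pos not_integrable_integral_eq by force
  have "(\<integral>\<^sup>+E. ennreal (poly p E) \<partial>\<nu>) = (\<integral>\<^sup>+E. ennreal (indicator ?S E *\<^sub>R poly p E) \<partial>\<nu>)"
    using ae by (intro nn_integral_cong_AE) (auto elim: eventually_mono)
  also have "\<dots> = ennreal (LINT E|\<nu>. indicator ?S E *\<^sub>R poly p E)"
    using int nonneg by (intro nn_integral_eq_integral) auto
  finally show ?thesis unfolding eq .
qed

text \<open>In \<open>P(J) P(J)\<close> one factor acts on the first basis vector and the other is
  moved to the left side; both give the product of the \<open>a j\<close> times the same unit
  vector. Positivity of that product yields integrability.\<close>

lemma nn_integral_jacobi_poly_square:
  assumes jac: "is_jacobi_operator a b J" and spec: "is_spectral_measure J (ell2_delta 1) \<nu>"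
    and a_pos: "\<And>n. n \<ge> 1 \<Longrightarrow> a n > 0"
  shows "(\<integral>\<^sup>+E. ennreal ((poly (jacobi_poly a b n) E)\<^sup>2) \<partial>\<nu>) = ennreal ((\<Prod>j=1..n. a j)\<^sup>2)"
proof -
  let ?P = "jacobi_poly a b n :: real poly"
  have d: "inner (ell2_delta m) (ell2_delta m) = 1" if "m \<ge> 1" for m
    using that by (simp add: ell2_inner_delta ell2_delta.rep_eq)
  have eq: "inner (ell2_delta 1) (blinfun_apply (blinfun_poly (?P\<^sup>2) J) (ell2_delta 1))
      = (\<Prod>j=1..n. a j)\<^sup>2"
    unfolding power2_eq_square blinfun_poly_mult
    using d[of "Suc n"] jac
    by (simp only: blinfun_compose.rep_eq o_apply jacobi_poly_apply_delta[OF jac]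
        inner_delta_jacobi_poly[OF jac] blinfun.scaleR_right inner_scaleR_right)
  have "ell2_delta 1 \<noteq> 0" using d[of 1] by auto
  moreover have "(\<Prod>j=1..n. a j) > 0" using a_pos by (intro prod_pos) auto
  then have "inner (ell2_delta 1) (blinfun_apply (blinfun_poly (?P\<^sup>2) J) (ell2_delta 1)) > 0"
    unfolding eq by (rule zero_less_power)
  ultimately show ?thesis
    using spectral_measure_nn_integral_poly[OF spec, of "?P\<^sup>2"] unfolding eq poly_power by auto
qed

section \<open>Logarithmic potentials of trigonometric weights\<close>

text \<open>The arcsine law on [-2, 2] in the angle variable \<open>E = 2 cos t\<close>, in which
  weights and logarithms become cosine series.\<close>

definition angle_measure :: "real measure" where
  "angle_measure = density lborel (\<lambda>t. ennreal (indicator {0..pi} t / pi))"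

lemma sets_angle_measure [simp, measurable_cong]: "sets angle_measure = sets borel"
  by (simp add: angle_measure_def)

lemma space_angle_measure [simp]: "space angle_measure = UNIV"
  by (simp add: angle_measure_def)

text \<open>Negative \<open>j\<close> is included because product formulas produce the frequencies
  \<open>k - 1\<close> and \<open>k - 2\<close>.\<close>

lemma has_bochner_integral_angle_measure_cos:
  "has_bochner_integral angle_measure (\<lambda>t. cos (of_int j * t)) (if j = 0 then 1 else 0)"
  unfolding angle_measure_def
proof (rule has_bochner_integral_density)
  define F where "F = (\<lambda>t::real. if j = 0 then t / pi else sin (of_int j * t) / (of_int j * pi))"
  have "DERIV F t :> cos (of_int j * t) / pi" for t
    unfolding F_def by (cases "j = 0") (auto intro!: derivative_eq_intros)
  then have "has_bochner_integral lborel (\<lambda>t. cos (of_int j * t) / pi * indicator {0..pi} t) (F pi - F 0)"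
    by (intro has_bochner_integral_FTC_Icc_real) auto
  moreover have "F pi - F 0 = (if j = 0 then 1 else 0)"
    by (simp add: F_def sin_integer_2pi sin_zero_iff_int2 mult.commute)
  ultimately show "has_bochner_integral lborel (\<lambda>t. (indicator {0..pi} t / pi) *\<^sub>R cos (of_int j * t))
      (if j = 0 then 1 else 0)"
    by (simp add: field_simps)
qed auto

lemma finite_measure_angle_measure: "finite_measure angle_measure"
  and measure_angle_measure: "measure angle_measure UNIV = 1"
proof -
  have "has_bochner_integral angle_measure (\<lambda>t. 1 :: real) 1"
    using has_bochner_integral_angle_measure_cos[of 0] by simp
  then have *: "integrable angle_measure (\<lambda>t. 1 :: real)" "(LINT t|angle_measure. 1 :: real) = 1"
    by (auto simp: has_bochner_integral_iff)
  then have "emeasure angle_measure UNIV = 1"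
    using nn_integral_eq_integral[OF *(1)] by simp
  then show "finite_measure angle_measure" "measure angle_measure UNIV = 1"
    by (auto intro: finite_measureI simp: measure_def)
qed

text \<open>Used with parameters \<open>3/4, s, 1/4\<close>, which give
  \<open>(2 + s E)^2 / 8\<close>, and with \<open>1, 0, 0\<close> for the plain potential.\<close>

definition trig_weight :: "real \<Rightarrow> real \<Rightarrow> real \<Rightarrow> real \<Rightarrow> real" where
  "trig_weight \<alpha> \<beta> \<gamma> t = \<alpha> + \<beta> * cos t + \<gamma> * cos (2 * t)"

lemma borel_measurable_trig_weight [measurable]: "trig_weight \<alpha> \<beta> \<gamma> \<in> borel_measurable borel"
  unfolding trig_weight_def by measurable

text \<open>The product-to-sum formulas leave only the frequencies of the weight itself.\<close>

lemma has_bochner_integral_cos_trig_weight: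
  "has_bochner_integral angle_measure (\<lambda>t. cos (real k * t) * trig_weight \<alpha> \<beta> \<gamma> t)
     (if k = 0 then \<alpha> else if k = 1 then \<beta> / 2 else if k = 2 then \<gamma> / 2 else 0)"
proof -
  define I where "I = (\<lambda>j::int. if j = 0 then 1 else (0::real))"
  have c: "has_bochner_integral angle_measure (\<lambda>t. cos (of_int j * t)) (I j)" for j
    unfolding I_def by (rule has_bochner_integral_angle_measure_cos)
  have "has_bochner_integral angle_measure
    (\<lambda>t. \<alpha> * cos (of_int (int k) * t)
      + (\<beta> / 2 * cos (of_int (int k + 1) * t) + \<beta> / 2 * cos (of_int (int k - 1) * t)
      + (\<gamma> / 2 * cos (of_int (int k + 2) * t) + \<gamma> / 2 * cos (of_int (int k - 2) * t))))
    (\<alpha> * I (int k) + (\<beta> / 2 * I (int k + 1) + \<beta> / 2 * I (int k - 1)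
      + (\<gamma> / 2 * I (int k + 2) + \<gamma> / 2 * I (int k - 2))))"
    by (intro has_bochner_integral_add has_bochner_integral_mult_right c)
  moreover have "(\<lambda>t. \<alpha> * cos (of_int (int k) * t)
      + (\<beta> / 2 * cos (of_int (int k + 1) * t) + \<beta> / 2 * cos (of_int (int k - 1) * t)
      + (\<gamma> / 2 * cos (of_int (int k + 2) * t) + \<gamma> / 2 * cos (of_int (int k - 2) * t))))
    = (\<lambda>t. cos (real k * t) * trig_weight \<alpha> \<beta> \<gamma> t)"
    by (auto simp: trig_weight_def cos_add cos_diff algebra_simps)
  moreover have "\<alpha> * I (int k) + (\<beta> / 2 * I (int k + 1) + \<beta> / 2 * I (int k - 1)
      + (\<gamma> / 2 * I (int k + 2) + \<gamma> / 2 * I (int k - 2)))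
    = (if k = 0 then \<alpha> else if k = 1 then \<beta> / 2 else if k = 2 then \<gamma> / 2 else 0)"
    by (auto simp: I_def)
  ultimately show ?thesis by simp
qed

text \<open>The sum of the real parts of the logarithmic series at \<open>z cis t\<close> and
  \<open>z cis (- t)\<close>; the sines cancel. The term at \<open>k = 0\<close> is 0 because
  division by 0 gives 0.\<close>

lemma ln_cmod_series:
  assumes "cmod z < 1"
  shows "(\<lambda>k. - 2 / real k * Re (z ^ k) * cos (real k * t))
    sums ln (cmod ((1 - z * cis t) * (1 - z * cis (- t))))"
proof -
  have *: "(\<lambda>k. Re (- ((z * cis u) ^ k) / of_nat k)) sums ln (cmod (1 - z * cis u))" for u
  proof -
    have n: "cmod (- (z * cis u)) < 1" using assms by (simp add: norm_mult)
    then have "1 - z * cis u \<noteq> 0"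
      by (metis eq_iff_diff_eq_0 less_irrefl norm_minus_cancel norm_one)
    then show ?thesis using sums_Re[OF Ln_series'[OF n]] by simp
  qed
  have nz: "cmod (1 - z * cis u) > 0" for u
    using assms norm_mult[of z "cis u"]
    by (metis eq_iff_diff_eq_0 less_irrefl mult.right_neutral norm_cis norm_one zero_less_norm_iff)
  have "(\<lambda>k. Re (- ((z * cis t) ^ k) / of_nat k) + Re (- ((z * cis (- t)) ^ k) / of_nat k))
      sums (ln (cmod (1 - z * cis t)) + ln (cmod (1 - z * cis (- t))))"
    by (intro sums_add *)
  moreover have "Re (- ((z * cis u) ^ k) / of_nat k)
      = - (Re (z ^ k) * cos (real k * u) - Im (z ^ k) * sin (real k * u)) / real k" for u k
    by (simp only: power_mult_distrib Complex.DeMoivre Re_divide_of_nat uminus_complex.sel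
        times_complex.sel cis.sel)
  then have "Re (- ((z * cis t) ^ k) / of_nat k) + Re (- ((z * cis (- t)) ^ k) / of_nat k)
      = - 2 / real k * Re (z ^ k) * cos (real k * t)" for k
    by (simp only:) (cases "k = 0"; simp add: field_simps)
  ultimately show ?thesis
    using nz[of t] nz[of "- t"] by (simp add: norm_mult ln_mult)
qed

lemma abs_trig_weight_le: "\<bar>trig_weight \<alpha> \<beta> \<gamma> t\<bar> \<le> \<bar>\<alpha>\<bar> + \<bar>\<beta>\<bar> + \<bar>\<gamma>\<bar>"
proof -
  have "\<bar>\<beta> * cos t\<bar> \<le> \<bar>\<beta>\<bar>" "\<bar>\<gamma> * cos (2 * t)\<bar> \<le> \<bar>\<gamma>\<bar>"
    by (simp_all add: abs_mult mult_left_le)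
  then show ?thesis unfolding trig_weight_def by linarith
qed

text \<open>Termwise integration, dominated by a geometric series; orthogonality of the cosines
  leaves only \<open>k = 1\<close> and \<open>k = 2\<close>.\<close>

lemma has_bochner_integral_ln_cmod_trig_weight:
  assumes "cmod z < 1"
  shows "has_bochner_integral angle_measure
    (\<lambda>t. ln (cmod ((1 - z * cis t) * (1 - z * cis (- t)))) * trig_weight \<alpha> \<beta> \<gamma> t)
    (- \<beta> * Re z - \<gamma> / 2 * Re (z\<^sup>2))"
proof -
  interpret finite_measure angle_measure by (rule finite_measure_angle_measure)
  define f where "f = (\<lambda>k t. - 2 / real k * Re (z ^ k) * (cos (real k * t) * trig_weight \<alpha> \<beta> \<gamma> t))"
  define W where "W = \<bar>\<alpha>\<bar> + \<bar>\<beta>\<bar> + \<bar>\<gamma>\<bar>"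
  have f: "has_bochner_integral angle_measure (f k) (- 2 / real k * Re (z ^ k) *
      (if k = 0 then \<alpha> else if k = 1 then \<beta> / 2 else if k = 2 then \<gamma> / 2 else 0))" for k
    unfolding f_def
    by (intro has_bochner_integral_mult_right has_bochner_integral_cos_trig_weight)
  have bound: "norm (f k t) \<le> 2 * W * cmod z ^ k" for k t
  proof -
    have "\<bar>Re (z ^ k)\<bar> \<le> cmod z ^ k" using abs_Re_le_cmod[of "z ^ k"] by (simp add: norm_power)
    moreover have "\<bar>- 2 / real k\<bar> \<le> 2" by (cases "k = 0") (auto simp: field_simps)
    moreover have "\<bar>cos (real k * t) * trig_weight \<alpha> \<beta> \<gamma> t\<bar> \<le> 1 * W"
      unfolding abs_mult W_def by (intro mult_mono abs_trig_weight_le) auto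
    ultimately have "\<bar>- 2 / real k\<bar> * \<bar>Re (z ^ k)\<bar> * \<bar>cos (real k * t) * trig_weight \<alpha> \<beta> \<gamma> t\<bar>
        \<le> 2 * cmod z ^ k * (1 * W)"
      by (intro mult_mono) auto
    then show ?thesis by (simp add: f_def abs_mult ac_simps)
  qed
  have geo: "summable (\<lambda>k. 2 * W * cmod z ^ k)"
    using assms by (intro summable_mult summable_geometric) auto
  have f_sums: "(\<lambda>k. f k t) sums (ln (cmod ((1 - z * cis t) * (1 - z * cis (- t)))) * trig_weight \<alpha> \<beta> \<gamma> t)" for t
    using sums_mult2[OF ln_cmod_series[OF assms, of t], of "trig_weight \<alpha> \<beta> \<gamma> t"]
    by (simp add: f_def mult.assoc)
  have int: "integrable angle_measure (f k)" for k using f by (rule integrable.intros)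
  have ae: "AE t in angle_measure. summable (\<lambda>k. norm (f k t))"
    by (intro AE_I2 summable_comparison_test'[OF geo, of 0]) (use bound in simp)
  have "(LINT t|angle_measure. norm (f k t)) \<le> (LINT t|angle_measure. 2 * W * cmod z ^ k)" for k
    using int bound by (intro integral_mono integrable_norm) auto
  then have "(LINT t|angle_measure. norm (f k t)) \<le> 2 * W * cmod z ^ k" for k
    by (simp add: measure_angle_measure)
  then have sm: "summable (\<lambda>k. LINT t|angle_measure. norm (f k t))"
    by (intro summable_comparison_test'[OF geo, of 0]) simp
  have eq: "(\<lambda>t. \<Sum>k. f k t)
      = (\<lambda>t. ln (cmod ((1 - z * cis t) * (1 - z * cis (- t)))) * trig_weight \<alpha> \<beta> \<gamma> t)"
    using sums_unique[OF f_sums] by (intro ext) simp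
  have "(\<lambda>k. LINT t|angle_measure. f k t) = (\<lambda>k. - 2 / real k * Re (z ^ k) *
      (if k = 0 then \<alpha> else if k = 1 then \<beta> / 2 else if k = 2 then \<gamma> / 2 else 0))"
    using f by (auto simp: has_bochner_integral_iff)
  also have "\<dots> sums (\<Sum>k\<in>{1, 2}. - 2 / real k * Re (z ^ k) *
      (if k = 0 then \<alpha> else if k = 1 then \<beta> / 2 else if k = 2 then \<gamma> / 2 else 0))"
    by (rule sums_finite) auto
  finally have "(LINT t|angle_measure. (\<Sum>k. f k t)) = (\<Sum>k\<in>{1, 2}. - 2 / real k * Re (z ^ k) *
      (if k = 0 then \<alpha> else if k = 1 then \<beta> / 2 else if k = 2 then \<gamma> / 2 else 0))"
    using sums_integral[OF int ae sm] sums_unique2 by blast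
  also have "\<dots> = - \<beta> * Re z - \<gamma> / 2 * Re (z\<^sup>2)" by simp
  finally show ?thesis
    using integrable_suminf[OF int ae sm] by (simp add: has_bochner_integral_iff eq)
qed

text \<open>The cosine is injective on [0, pi]. This excludes the logarithmic singularity, where
  \<open>ln 0 = 0\<close> would spoil the passage to the limit.\<close>

lemma AE_angle_measure_cos: "AE t in angle_measure. 2 * cos t \<noteq> x"
proof -
  have "{t \<in> {0..pi}. 2 * cos t = x} \<subseteq> {arccos (x / 2)}" by (auto simp: arccos_cos)
  then have "finite {t \<in> {0..pi}. 2 * cos t = x}" using finite_subset by blast
  then have "AE t in lborel. t \<notin> {t \<in> {0..pi}. 2 * cos t = x}"
    by (intro AE_not_in finite_imp_null_set_lborel)
  then show ?thesis unfolding angle_measure_def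
    by (subst AE_density) (auto elim!: eventually_mono split: split_indicator)
qed

section \<open>Lower bound for the potential at a real point\<close>

text \<open>Reverse Fatou along \<open>r z\<close> with \<open>r \<rightarrow> 1\<close>; the roots of \<open>w\<^sup>2 - x w + 1\<close>
  on the unit circle give logarithmic singularities.\<close>

lemma integral_ln_trig_weight_ge:
  fixes x :: real and z :: complex
  assumes z: "z \<noteq> 0" "cmod z \<le> 1" "z + 1 / z = of_real x"
    and nonneg: "\<And>t. trig_weight \<alpha> \<beta> \<gamma> t \<ge> 0"
  shows "integrable angle_measure (\<lambda>t. trig_weight \<alpha> \<beta> \<gamma> t * ln \<bar>2 * cos t - x\<bar>)"
    and "(LINT t|angle_measure. trig_weight \<alpha> \<beta> \<gamma> t * ln \<bar>2 * cos t - x\<bar>)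
      \<ge> - \<alpha> * ln (cmod z) - \<beta> * Re z - \<gamma> / 2 * Re (z\<^sup>2)"
proof -
  interpret finite_measure angle_measure by (rule finite_measure_angle_measure)
  \<comment> \<open>Values in [1/2, 1) keep \<open>r z\<close> inside the open disc and the
    denominator of \<open>g\<close> away from 0.\<close>
  define r where "r = (\<lambda>i. 1 - 1 / (real i + 2))"
  have r: "1 / 2 \<le> r i" "r i < 1" for i by (auto simp: r_def field_simps)
  have r_lim: "r \<longlonglongrightarrow> 1" unfolding r_def by real_asymp
  \<comment> \<open>At \<open>s = 1\<close> this is \<open>|2 cos t - x|\<close>, because
    \<open>(1 - z cis t) (1 - z cis (- t)) = z (x - 2 cos t)\<close>. \<open>C\<close> bounds
    \<open>ln g\<close> from above, with 8 = 2 * 2 / (1/2), and \<open>V s\<close> is the weighted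
    integral of \<open>ln (g s t)\<close>.\<close>
  define g where "g = (\<lambda>s t. cmod ((1 - of_real s * z * cis t) * (1 - of_real s * z * cis (- t))) / (s * cmod z))"
  define C where "C = ln (8 / cmod z)"
  define V where "V = (\<lambda>s. - \<alpha> * ln (s * cmod z) - \<beta> * s * Re z - \<gamma> / 2 * s\<^sup>2 * Re (z\<^sup>2))"
  let ?w = "trig_weight \<alpha> \<beta> \<gamma>"
  have z0: "cmod z > 0" using z by simp
  have zr: "cmod (of_real (r i) * z) < 1" for i
  proof -
    have "0 \<le> r i" using r[of i] by linarith
    moreover from this have "r i * cmod z \<le> r i * 1" using z(2) by (intro mult_left_mono)
    then have "r i * cmod z < 1" using r[of i] by linarith
    ultimately show ?thesis by (simp add: norm_mult)
  qed
  have g_pos: "g (r i) t > 0" for i t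
  proof -
    have "cmod (of_real (r i) * z * cis u) < 1" for u
      using zr[of i] by (simp add: norm_mult)
    then have "1 - of_real (r i) * z * cis u \<noteq> 0" for u
      by (metis eq_iff_diff_eq_0 less_irrefl norm_one)
    then show ?thesis unfolding g_def using r[of i] z0 by (intro divide_pos_pos) (auto simp: norm_mult)
  qed
  have g_le: "g (r i) t \<le> 8 / cmod z" for i t
  proof -
    have "cmod (1 - of_real (r i) * z * cis u) \<le> 2" for u
    proof -
      have "cmod (1 - of_real (r i) * z * cis u) \<le> 1 + cmod (of_real (r i) * z * cis u)"
        by (metis norm_one norm_triangle_ineq4)
      also have "cmod (of_real (r i) * z * cis u) \<le> 1"
        using zr[of i] by (simp add: norm_mult)
      finally show ?thesis by simp
    qed
    then have "cmod ((1 - of_real (r i) * z * cis t) * (1 - of_real (r i) * z * cis (- t))) \<le> 2 * 2"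
      unfolding norm_mult by (intro mult_mono) auto
    then have "g (r i) t \<le> (2 * 2) / (1 / 2 * cmod z)"
      unfolding g_def using r[of i] z0 by (intro frac_le mult_right_mono) auto
    then show ?thesis by (simp add: field_simps)
  qed
  have u_nonneg: "?w t * (C - ln (g (r i) t)) \<ge> 0" for i t
  proof -
    have "ln (g (r i) t) \<le> C"
      unfolding C_def using g_pos[of i t] g_le[of i t] z0 by (subst ln_le_cancel_iff) auto
    then show ?thesis by (intro mult_nonneg_nonneg nonneg) simp
  qed
  have int_g: "has_bochner_integral angle_measure (\<lambda>t. ?w t * (C - ln (g (r i) t))) (\<alpha> * C - V (r i))" for i
  proof -
    have "has_bochner_integral angle_measure (\<lambda>t. (C + ln (r i * cmod z)) * ?w t
        - ln (cmod ((1 - of_real (r i) * z * cis t) * (1 - of_real (r i) * z * cis (- t)))) * ?w t)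
        ((C + ln (r i * cmod z)) * \<alpha>
          - (- \<beta> * Re (of_real (r i) * z) - \<gamma> / 2 * Re ((of_real (r i) * z)\<^sup>2)))"
      using has_bochner_integral_cos_trig_weight[of 0 \<alpha> \<beta> \<gamma>]
        has_bochner_integral_ln_cmod_trig_weight[OF zr[of i], of \<alpha> \<beta> \<gamma>]
      by (intro has_bochner_integral_diff has_bochner_integral_mult_right) auto
    moreover have "(\<lambda>t. (C + ln (r i * cmod z)) * ?w t
        - ln (cmod ((1 - of_real (r i) * z * cis t) * (1 - of_real (r i) * z * cis (- t)))) * ?w t)
      = (\<lambda>t. ?w t * (C - ln (g (r i) t)))"
    proof
      fix t
      have "ln (g (r i) t)
          = ln (cmod ((1 - of_real (r i) * z * cis t) * (1 - of_real (r i) * z * cis (- t))))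
            - ln (r i * cmod z)"
        using g_pos[of i t] r[of i] z0 unfolding g_def
        by (subst ln_div) (auto simp: zero_less_divide_iff)
      then show "(C + ln (r i * cmod z)) * ?w t
          - ln (cmod ((1 - of_real (r i) * z * cis t) * (1 - of_real (r i) * z * cis (- t)))) * ?w t
        = ?w t * (C - ln (g (r i) t))"
        by (simp only:) (simp only: algebra_simps)
    qed
    moreover have "(C + ln (r i * cmod z)) * \<alpha>
          - (- \<beta> * Re (of_real (r i) * z) - \<gamma> / 2 * Re ((of_real (r i) * z)\<^sup>2)) = \<alpha> * C - V (r i)"
      by (simp add: V_def algebra_simps power_mult_distrib flip: of_real_power)
    ultimately show ?thesis by simp
  qed
  have g_lim: "(\<lambda>i. g (r i) t) \<longlonglongrightarrow> \<bar>2 * cos t - x\<bar>" for t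
  proof -
    have "(\<lambda>i. g (r i) t) \<longlonglongrightarrow> g 1 t"
      unfolding g_def using z0 by (intro tendsto_intros r_lim) auto
    moreover have "g 1 t = \<bar>2 * cos t - x\<bar>"
    proof -
      have "(1 - z * cis t) * (1 - z * cis (- t)) = z * (of_real x - of_real (2 * cos t))"
      proof -
        have "(1 - z * cis t) * (1 - z * cis (- t)) = 1 + z\<^sup>2 * (cis t * cis (- t)) - z * (cis t + cis (- t))"
          by (simp add: algebra_simps power2_eq_square)
        also have "cis t * cis (- t) = 1" by (simp add: cis_mult)
        also have "cis t + cis (- t) = of_real (2 * cos t)" by (simp add: complex_eq_iff)
        also have "1 + z\<^sup>2 * 1 = z * of_real x"
          using z by (simp flip: z(3) add: field_simps power2_eq_square)
        finally show ?thesis by (simp add: algebra_simps)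
      qed
      then have "g 1 t = cmod (z * of_real (x - 2 * cos t)) / cmod z" by (simp add: g_def)
      also have "\<dots> = \<bar>x - 2 * cos t\<bar>" using z0 by (simp only: norm_mult norm_of_real) simp
      finally show ?thesis by linarith
    qed
    ultimately show ?thesis by simp
  qed
  define h where "h = (\<lambda>t. ?w t * (C - ln \<bar>2 * cos t - x\<bar>))"
  have ln_le: "ln \<bar>2 * cos t - x\<bar> \<le> C" for t
  proof (cases "2 * cos t = x")
    case True
    \<comment> \<open>Here \<open>ln 0 = 0\<close>, so the claim is
      \<open>0 \<le> C\<close>.\<close>
    have "cmod z \<le> 8" using z(2) by simp
    then show ?thesis using True z0 by (simp add: C_def)
  next
    case False
    then show ?thesis unfolding C_def
      using LIMSEQ_le_const2[OF g_lim[of t], of "8 / cmod z"] g_le z0 by (subst ln_le_cancel_iff) auto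
  qed
  have h_nonneg: "h t \<ge> 0" for t unfolding h_def using nonneg ln_le by simp
  have h_meas [measurable]: "h \<in> borel_measurable angle_measure"
    unfolding h_def by measurable
  have u_meas [measurable]: "(\<lambda>t. ?w t * (C - ln (g (r i) t))) \<in> borel_measurable angle_measure" for i
    using int_g by (rule borel_measurable_has_bochner_integral)
  have V_lim: "(\<lambda>i. \<alpha> * C - V (r i)) \<longlonglongrightarrow> \<alpha> * C - V 1"
    unfolding V_def using z0 by (intro tendsto_intros r_lim) auto
  have "(\<integral>\<^sup>+t. ennreal (h t) \<partial>angle_measure)
      = (\<integral>\<^sup>+t. liminf (\<lambda>i. ennreal (?w t * (C - ln (g (r i) t)))) \<partial>angle_measure)"
  proof (rule nn_integral_cong_AE)
    show "AE t in angle_measure. ennreal (h t) = liminf (\<lambda>i. ennreal (?w t * (C - ln (g (r i) t))))"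
      using AE_angle_measure_cos[of x]
    proof eventually_elim
      case (elim t)
      then have "(\<lambda>i. ennreal (?w t * (C - ln (g (r i) t)))) \<longlonglongrightarrow> ennreal (h t)"
        unfolding h_def by (intro tendsto_ennrealI tendsto_intros g_lim) auto
      then show ?case by (simp add: lim_imp_Liminf)
    qed
  qed
  \<comment> \<open>Fatou's lemma for the nonnegative functions obtained by subtracting from
    \<open>C\<close>; the sign turns its upper bound into a lower bound for the logarithm.\<close>
  also have "\<dots> \<le> liminf (\<lambda>i. \<integral>\<^sup>+t. ennreal (?w t * (C - ln (g (r i) t))) \<partial>angle_measure)"
    by (rule nn_integral_liminf) measurable
  also have "\<dots> = liminf (\<lambda>i. ennreal (\<alpha> * C - V (r i)))"
  proof -
    have "(\<integral>\<^sup>+t. ennreal (?w t * (C - ln (g (r i) t))) \<partial>angle_measure) = ennreal (\<alpha> * C - V (r i))" for i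
      using int_g[of i] u_nonneg
      by (subst nn_integral_eq_integral) (auto simp: has_bochner_integral_iff)
    then show ?thesis by simp
  qed
  also have "\<dots> = ennreal (\<alpha> * C - V 1)"
    using tendsto_ennrealI[OF V_lim] by (simp add: lim_imp_Liminf)
  finally have le: "(\<integral>\<^sup>+t. ennreal (h t) \<partial>angle_measure) \<le> ennreal (\<alpha> * C - V 1)" .
  have int_h: "integrable angle_measure h"
    using le h_nonneg by (intro integrableI_nonneg) (auto simp: le_less_trans)
  have w: "has_bochner_integral angle_measure ?w \<alpha>"
    using has_bochner_integral_cos_trig_weight[of 0 \<alpha> \<beta> \<gamma>] by simp
  have eq: "(\<lambda>t. ?w t * ln \<bar>2 * cos t - x\<bar>) = (\<lambda>t. C * ?w t - h t)"
    by (auto simp: h_def algebra_simps)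
  have wC: "integrable angle_measure (\<lambda>t. C * ?w t)" "(LINT t|angle_measure. C * ?w t) = C * \<alpha>"
    using w by (auto simp: has_bochner_integral_iff)
  show "integrable angle_measure (\<lambda>t. ?w t * ln \<bar>2 * cos t - x\<bar>)"
    unfolding eq using wC int_h by (intro Bochner_Integration.integrable_diff)
  have "(LINT t|angle_measure. h t) \<le> \<alpha> * C - V 1"
  proof -
    \<comment> \<open>\<open>ennreal\<close> truncates negative numbers, so the comparison returns
      to the reals only once the right side is known to be nonnegative.\<close>
    have 0: "0 \<le> \<alpha> * C - V 1"
    proof (rule LIMSEQ_le_const[OF V_lim], intro exI allI impI)
      fix i
      have "0 \<le> (LINT t|angle_measure. ?w t * (C - ln (g (r i) t)))"
        using u_nonneg by (intro integral_nonneg_AE AE_I2)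
      then show "0 \<le> \<alpha> * C - V (r i)" using int_g[of i] by (simp add: has_bochner_integral_iff)
    qed
    have "ennreal (LINT t|angle_measure. h t) \<le> ennreal (\<alpha> * C - V 1)"
      using le nn_integral_eq_integral[OF int_h] h_nonneg by simp
    then show ?thesis using 0 by simp
  qed
  then show "(LINT t|angle_measure. ?w t * ln \<bar>2 * cos t - x\<bar>)
      \<ge> - \<alpha> * ln (cmod z) - \<beta> * Re z - \<gamma> / 2 * Re (z\<^sup>2)"
    unfolding eq Bochner_Integration.integral_diff[OF wC(1) int_h] wC(2)
    by (simp add: V_def algebra_simps)
qed


text \<open>The preimage of \<open>x\<close> in the closed unit disc under the Joukowski map:
  \<open>cis t\<close> for \<open>x = 2 cos t\<close>, with equality in the bound, and
  \<open>sgn x * exp (- t)\<close> for \<open>|x| = 2 cosh t\<close>.\<close>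

lemma exists_inverse_joukowski:
  fixes x :: real
  obtains z :: complex where "z \<noteq> 0" "cmod z \<le> 1" "z + 1 / z = of_real x"
    "\<And>s. s \<in> {1, -1} \<Longrightarrow>
      - (3 / 4) * ln (cmod z) - s * Re z - 1 / 4 / 2 * Re (z\<^sup>2) \<ge> - s * x / 2 - (x\<^sup>2 - 2) / 16"
proof (cases "\<bar>x\<bar> \<le> 2")
  case True
  define t where "t = arccos (x / 2)"
  have x: "x = 2 * cos t" using True by (simp add: t_def)
  have "(cis t)\<^sup>2 = cis (2 * t)" by (simp add: Complex.DeMoivre)
  then have "Re ((cis t)\<^sup>2) = 2 * (cos t)\<^sup>2 - 1" by (simp add: cos_double_cos)
  then have "- (3 / 4) * ln (cmod (cis t)) - s * Re (cis t) - 1 / 4 / 2 * Re ((cis t)\<^sup>2)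
      = - s * x / 2 - (x\<^sup>2 - 2) / 16" for s
    by (simp add: x power_mult_distrib)
  moreover have "cis t + 1 / cis t = of_real x"
    by (simp add: x complex_eq_iff flip: cis_inverse inverse_eq_divide)
  ultimately show ?thesis by (intro that[of "cis t"]) auto
next
  case False
  define t where "t = arcosh (\<bar>x\<bar> / 2)"
  have t: "t \<ge> 0" "cosh t = \<bar>x\<bar> / 2" using False by (auto simp: t_def cosh_arcosh_real)
  define z where "z = sgn x * exp (- t)"
  have "x \<noteq> 0" using False by auto
  then have sg: "sgn x * sgn x = 1" "x = sgn x * (2 * cosh t)" using t by (auto simp: sgn_if)
  have zx: "z + 1 / z = x"
    unfolding z_def using sg by (simp add: cosh_def exp_minus field_simps sgn_if split: if_splits)
  have ln: "ln \<bar>z\<bar> = - t" using \<open>x \<noteq> 0\<close> by (simp add: z_def abs_mult sgn_if)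
  \<comment> \<open>The excess of the potential over the quadratic bound; \<open>c\<close> will be
    \<open>s * sgn x\<close>. It vanishes at 0 and its derivative is half a square.\<close>
  have pos: "3 / 4 * u + c * sinh u + sinh (2 * u) / 8 \<ge> 0" if "u \<ge> 0" "c \<in> {1, -1}" for u c :: real
  proof -
    have "3 / 4 * 0 + c * sinh 0 + sinh (2 * 0) / 8 \<le> 3 / 4 * u + c * sinh u + sinh (2 * u) / 8"
    proof (rule DERIV_nonneg_imp_nondecreasing[OF that(1)])
      fix y :: real
      have "((\<lambda>u. 3 / 4 * u + c * sinh u + sinh (2 * u) / 8) has_real_derivative
          3 / 4 + c * cosh y + cosh (2 * y) / 4) (at y)"
        by (auto intro!: derivative_eq_intros)
      moreover have "3 / 4 + c * cosh y + cosh (2 * y) / 4 = (1 + c * cosh y)\<^sup>2 / 2"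
      proof -
        have "cosh (2 * y) = 2 * (cosh y)\<^sup>2 - 1"
          using cosh_double[of y] sinh_square_eq[of y] by simp
        moreover have "c\<^sup>2 = 1" using that(2) by auto
        ultimately show ?thesis by (simp add: power2_sum power_mult_distrib field_simps)
      qed
      ultimately show "\<exists>D. ((\<lambda>u. 3 / 4 * u + c * sinh u + sinh (2 * u) / 8) has_real_derivative D) (at y) \<and> 0 \<le> D"
        by auto
    qed
    then show ?thesis by simp
  qed
  have "- (3 / 4) * ln \<bar>z\<bar> - s * z - 1 / 4 / 2 * z\<^sup>2 \<ge> - s * x / 2 - (x\<^sup>2 - 2) / 16"
    if "s \<in> {1, -1}" for s
  proof -
    have z0: "z \<noteq> 0" using \<open>x \<noteq> 0\<close> by (simp add: z_def sgn_if)
    have z2: "z\<^sup>2 = exp (- (2 * t))" "(1 / z)\<^sup>2 = exp (2 * t)"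
      using sg(1) by (simp_all add: z_def power2_eq_square exp_minus field_simps flip: exp_add)
    have "x\<^sup>2 - 2 = z\<^sup>2 + (1 / z)\<^sup>2"
      using z0 by (simp add: power2_eq_square field_simps flip: zx)
    moreover have "x / 2 - z = sgn x * sinh t"
      by (subst sg(2)) (simp add: z_def cosh_def sinh_def field_simps)
    moreover have "- (3 / 4) * ln \<bar>z\<bar> - s * z - 1 / 4 / 2 * z\<^sup>2 - (- s * x / 2 - (x\<^sup>2 - 2) / 16)
        = - (3 / 4) * ln \<bar>z\<bar> + s * (x / 2 - z) + (x\<^sup>2 - 2) / 16 - z\<^sup>2 / 8"
      by (simp add: algebra_simps)
    ultimately have "- (3 / 4) * ln \<bar>z\<bar> - s * z - 1 / 4 / 2 * z\<^sup>2 - (- s * x / 2 - (x\<^sup>2 - 2) / 16)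
        = 3 / 4 * t + s * (sgn x * sinh t) + (exp (2 * t) - exp (- (2 * t))) / 16"
      by (simp only: ln z2) (simp add: field_simps)
    also have "\<dots> = 3 / 4 * t + s * sgn x * sinh t + sinh (2 * t) / 8"
      by (simp add: sinh_def)
    also have "\<dots> \<ge> 0"
      using that False t(1) by (intro pos) (auto simp: sgn_if)
    finally show ?thesis by simp
  qed
  moreover have "complex_of_real z + 1 / complex_of_real z = of_real x"
    using zx by (metis of_real_1 of_real_add of_real_divide)
  moreover have "z \<noteq> 0" "\<bar>z\<bar> \<le> 1" using False t(1) by (auto simp: z_def sgn_if abs_mult)
  ultimately show ?thesis by (intro that[of "of_real z"]) (auto simp flip: of_real_power)
qed

section \<open>The arcsine law\<close>

definition arcsine_law :: "real measure" where
  "arcsine_law = distr angle_measure borel (\<lambda>t. 2 * cos t)"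

lemma sets_arcsine_law [simp, measurable_cong]: "sets arcsine_law = sets borel"
  by (simp add: arcsine_law_def)

lemma space_arcsine_law [simp]: "space arcsine_law = UNIV"
  by (simp add: arcsine_law_def)

lemma finite_measure_arcsine_law: "finite_measure arcsine_law"
  unfolding arcsine_law_def
  by (intro finite_measure.finite_measure_distr finite_measure_angle_measure) measurable

lemma integrable_arcsine_law_iff:
  assumes [measurable]: "f \<in> borel_measurable borel"
  shows "integrable arcsine_law f \<longleftrightarrow> integrable angle_measure (\<lambda>t. f (2 * cos t :: real) :: real)"
  unfolding arcsine_law_def by (rule integrable_distr_eq) measurable

lemma integral_arcsine_law:
  assumes [measurable]: "f \<in> borel_measurable borel"
  shows "(LINT E|arcsine_law. f E) = (LINT t|angle_measure. f (2 * cos t :: real) :: real)"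
  unfolding arcsine_law_def by (rule integral_distr) measurable

text \<open>This makes the weight nonnegative, as reverse Fatou and Jensen require.\<close>

lemma trig_weight_square:
  assumes "s \<in> {1, -1}"
  shows "trig_weight (3 / 4) s (1 / 4) t = (2 + s * (2 * cos t))\<^sup>2 / 8"
  using assms unfolding trig_weight_def cos_double_cos[of t]
  by (auto simp: power2_eq_square field_simps)

lemma
  assumes "s \<in> {1, -1}"
  shows integrable_arcsine_law_weight: "integrable arcsine_law (\<lambda>E. (2 + s * E)\<^sup>2 / 8)"
    and integral_arcsine_law_weight: "(LINT E|arcsine_law. (2 + s * E)\<^sup>2 / 8) = 3 / 4"
  using has_bochner_integral_cos_trig_weight[of 0 "3 / 4" s "1 / 4"] trig_weight_square[OF assms]
  by (simp_all add: integrable_arcsine_law_iff integral_arcsine_law has_bochner_integral_iff)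

text \<open>The constant weight; the points \<open>x = 2\<close> and \<open>x = - 2\<close> will
  serve to integrate the logarithm of \<open>4 - E^2\<close>.\<close>

lemma integrable_arcsine_law_ln: "integrable arcsine_law (\<lambda>E. ln \<bar>E - x\<bar>)"
proof -
  obtain z where z: "z \<noteq> 0" "cmod z \<le> 1" "z + 1 / z = of_real x"
    using exists_inverse_joukowski by metis
  have 1: "trig_weight 1 0 0 = (\<lambda>t. 1)" by (auto simp: trig_weight_def)
  show ?thesis
    using integral_ln_trig_weight_ge(1)[OF z, of 1 0 0] unfolding 1
    by (subst integrable_arcsine_law_iff) simp_all
qed

text \<open>The potential bound in terms of \<open>z\<close> becomes a quadratic in
  \<open>x\<close>, so that its sum over roots involves only the first two power sums.\<close>

lemma
  assumes s: "s \<in> {1, -1}"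
  shows integrable_arcsine_law_weight_ln:
      "integrable arcsine_law (\<lambda>E. (2 + s * E)\<^sup>2 / 8 * ln \<bar>E - x\<bar>)"
    and integral_arcsine_law_weight_ln_ge:
      "(LINT E|arcsine_law. (2 + s * E)\<^sup>2 / 8 * ln \<bar>E - x\<bar>) \<ge> - s * x / 2 - (x\<^sup>2 - 2) / 16"
proof -
  obtain z where z: "z \<noteq> 0" "cmod z \<le> 1" "z + 1 / z = of_real x"
    "- (3 / 4) * ln (cmod z) - s * Re z - 1 / 4 / 2 * Re (z\<^sup>2) \<ge> - s * x / 2 - (x\<^sup>2 - 2) / 16"
    using exists_inverse_joukowski s by metis
  have "trig_weight (3 / 4) s (1 / 4) t \<ge> 0" for t by (simp add: trig_weight_square[OF s])
  note * = integral_ln_trig_weight_ge[OF z(1-3) this, unfolded trig_weight_square[OF s]]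
  show "integrable arcsine_law (\<lambda>E. (2 + s * E)\<^sup>2 / 8 * ln \<bar>E - x\<bar>)"
    using *(1) by (subst integrable_arcsine_law_iff) measurable
  show "(LINT E|arcsine_law. (2 + s * E)\<^sup>2 / 8 * ln \<bar>E - x\<bar>) \<ge> - s * x / 2 - (x\<^sup>2 - 2) / 16"
    using *(2) z(4) by (subst integral_arcsine_law) (measurable, linarith)
qed

lemma arcsine_law_eq_density:
  "arcsine_law = density lborel (\<lambda>E. ennreal (indicator {-2<..<2} E / (pi * sqrt (4 - E\<^sup>2))))"
    (is "_ = density _ ?d")
proof (rule measure_eqI)
  fix A assume "A \<in> sets arcsine_law"
  then have A [measurable]: "A \<in> sets borel" by simp
  define f where "f = (\<lambda>E. ?d E * indicator A E)"
  have [measurable]: "f \<in> borel_measurable borel" unfolding f_def by measurable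
  have "emeasure arcsine_law A = (\<integral>\<^sup>+t. indicator A (2 * cos t) \<partial>angle_measure)"
    unfolding arcsine_law_def
    by (subst nn_integral_indicator[symmetric], simp, subst nn_integral_distr) auto
  also have "\<dots> = (\<integral>\<^sup>+t. ennreal (indicator {0..pi} t / pi) * indicator A (2 * cos t) \<partial>lborel)"
    unfolding angle_measure_def by (subst nn_integral_density) auto
  \<comment> \<open>Reflection \<open>t -> pi - t\<close> makes the substituted map
    \<open>- 2 cos t\<close> nondecreasing.\<close>
  also have "\<dots> = (\<integral>\<^sup>+t. ennreal (indicator {0..pi} (pi + - 1 * t) / pi)
      * indicator A (2 * cos (pi + - 1 * t)) \<partial>lborel)"
    by (subst nn_integral_real_affine[where c = "-1" and t = pi]) auto
  also have "\<dots> = (\<integral>\<^sup>+t. f (- 2 * cos t) * ennreal (2 * sin t) * indicator {0..pi} t \<partial>lborel)"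
  proof (rule nn_integral_cong_AE)
    \<comment> \<open>The two sides may differ at 0 and pi, where the density is set to 0.\<close>
    show "AE t in lborel. ennreal (indicator {0..pi} (pi + - 1 * t) / pi) * indicator A (2 * cos (pi + - 1 * t))
        = f (- 2 * cos t) * ennreal (2 * sin t) * indicator {0..pi} t"
      using AE_lborel_singleton[of 0] AE_lborel_singleton[of pi]
    proof eventually_elim
      case (elim t)
      show ?case
      proof (cases "t \<in> {0<..<pi}")
        case True
        then have s: "sin t > 0" by (simp add: sin_gt_zero)
        have c: "\<bar>cos t\<bar> < 1"
          using s sin_cos_squared_add[of t] by (metis abs_square_less_1 add_le_same_cancel2 linorder_not_less
              not_less zero_less_power)
        have "sqrt (4 - (- 2 * cos t)\<^sup>2) = 2 * sin t"
          using s by (intro real_sqrt_unique) (auto simp: power_mult_distrib sin_squared_eq)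
        then have "?d (- 2 * cos t) * ennreal (2 * sin t) = ennreal (1 / pi)"
          using c s by (simp add: abs_less_iff flip: ennreal_mult')
        moreover have "f (- 2 * cos t) * ennreal (2 * sin t)
            = ?d (- 2 * cos t) * ennreal (2 * sin t) * indicator A (- 2 * cos t)"
          by (simp only: f_def ac_simps)
        ultimately have "f (- 2 * cos t) * ennreal (2 * sin t)
            = ennreal (1 / pi) * indicator A (- 2 * cos t)"
          by (simp only:)
        then show ?thesis using True by (simp add: cos_diff)
      next
        case False
        then show ?thesis using elim by (auto split: split_indicator)
      qed
    qed
  qed
  also have "\<dots> = (\<integral>\<^sup>+E. f E * indicator {- 2 * cos 0..- 2 * cos pi} E \<partial>lborel)"
    by (rule nn_integral_substitution_aux[symmetric])
      (auto intro!: derivative_eq_intros continuous_intros simp: sin_ge_zero)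
  also have "\<dots> = (\<integral>\<^sup>+E. f E \<partial>lborel)"
    by (intro nn_integral_cong) (auto simp: f_def split: split_indicator)
  also have "\<dots> = emeasure (density lborel ?d) A"
    unfolding f_def by (subst emeasure_density) auto
  finally show "emeasure arcsine_law A = emeasure (density lborel ?d) A" .
qed simp

section \<open>The Szego integral\<close>

lemma borel_measurable_ac_density [measurable]: "ac_density \<nu> \<in> borel_measurable borel"
proof -
  have [measurable]: "RN_deriv lborel (ac_part \<nu>) \<in> borel_measurable borel" by simp
  show ?thesis unfolding ac_density_def[abs_def] by measurable
qed

lemma ac_density_nonneg: "ac_density \<nu> E \<ge> 0"
  by (simp add: ac_density_def)

lemma borel_measurable_szego_integrand [measurable]: "szego_integrand \<nu> \<in> borel_measurable borel"
  unfolding szego_integrand_def[abs_def] by measurable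

text \<open>The singular part is dropped, and \<open>enn2real\<close> sends infinity to 0; both only
  decrease the integral.\<close>

lemma nn_integral_ac_density_le:
  assumes fin: "finite_measure \<nu>" and sets: "sets \<nu> = sets borel"
    and [measurable]: "h \<in> borel_measurable borel"
  shows "(\<integral>\<^sup>+E. h E * ennreal (ac_density \<nu> E) \<partial>lborel) \<le> (\<integral>\<^sup>+E. h E \<partial>\<nu>)"
proof -
  obtain \<nu>s where dec: "is_lebesgue_decomposition \<nu> (ac_part \<nu>) \<nu>s"
    using ac_part_decomposition[OF fin sets] by blast
  have sets_ac: "sets (ac_part \<nu>) = sets borel"
    using dec unfolding is_lebesgue_decomposition_def by blast
  have dens: "density lborel (RN_deriv lborel (ac_part \<nu>)) = ac_part \<nu>"
    using dec unfolding is_lebesgue_decomposition_def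
    by (intro sigma_finite_measure.density_RN_deriv) (auto intro: sigma_finite_lborel)
  have "(\<integral>\<^sup>+E. h E * ennreal (ac_density \<nu> E) \<partial>lborel)
      \<le> (\<integral>\<^sup>+E. RN_deriv lborel (ac_part \<nu>) E * h E \<partial>lborel)"
    unfolding ac_density_def
    by (intro nn_integral_mono) (auto simp: ennreal_enn2real_if mult.commute intro!: mult_left_mono)
  also have "\<dots> = (\<integral>\<^sup>+E. h E \<partial>ac_part \<nu>)"
    by (subst (2) dens[symmetric], subst nn_integral_density) auto
  also have "\<dots> \<le> (\<integral>\<^sup>+E. h E \<partial>\<nu>)"
  proof (rule nn_integral_mono_measure)
    show "sets (ac_part \<nu>) = sets \<nu>" using sets sets_ac by simp
    moreover have "emeasure (ac_part \<nu>) A \<le> emeasure \<nu> A" for A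
    proof (cases "A \<in> sets borel")
      case True
      then show ?thesis using dec unfolding is_lebesgue_decomposition_def by simp
    next
      case False
      then show ?thesis using sets_ac by (simp add: emeasure_notin_sets)
    qed
    ultimately show "ac_part \<nu> \<le> \<nu>" by (simp add: le_measure le_fun_def)
  qed
  finally show ?thesis .
qed

text \<open>The negative part of the Szego integral is always finite, so the positive part is finite
  as well. The integrand is infinite where the density vanishes, which can then happen only on a
  null set of (-2, 2).\<close>

lemma
  assumes fin: "finite_measure \<nu>" and sets: "sets \<nu> = sets borel"
    and Z: "szego_integral \<nu> \<noteq> \<infinity>"
  shows AE_ac_density_pos: "AE E in arcsine_law. ac_density \<nu> E > 0"
    and integrable_szego_positive_part:
      "integrable arcsine_law (\<lambda>E. max 0 (ln (sqrt (4 - E\<^sup>2) / (2 * pi * ac_density \<nu> E))))"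
proof -
  define I where "I = (\<integral>\<^sup>+E\<in>{-2<..<2}. e2ennreal (szego_integrand \<nu> E) \<partial>lborel)"
  have I: "I \<noteq> \<infinity>"
  proof
    assume "I = \<infinity>"
    moreover have "enn2ereal (\<integral>\<^sup>+E\<in>{-2<..<2}. e2ennreal (- szego_integrand \<nu> E) \<partial>lborel) \<noteq> \<infinity>"
      using szego_integrand_negative_part_finite[OF fin sets]
      by (metis enn2ereal_eq_top_iff infinity_ennreal_def less_irrefl top_ereal_def)
    ultimately show False
      using Z unfolding szego_integral_def I_def[symmetric] by simp
  qed
  have "AE E in lborel. e2ennreal (szego_integrand \<nu> E) * indicator {-2<..<2} E \<noteq> \<infinity>"
    using I unfolding I_def by (intro nn_integral_PInf_AE) auto
  then have pos: "AE E in lborel. E \<in> {-2<..<2} \<longrightarrow> ac_density \<nu> E > 0"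
  proof eventually_elim
    case (elim E)
    show ?case
      using elim ac_density_nonneg[of \<nu> E]
      by (auto simp: szego_integrand_def less_le split: if_splits split_indicator_asm)
  qed
  then show "AE E in arcsine_law. ac_density \<nu> E > 0"
    unfolding arcsine_law_eq_density
    by (subst AE_density) (auto elim!: eventually_mono split: split_indicator)
  let ?l = "\<lambda>E. ln (sqrt (4 - E\<^sup>2) / (2 * pi * ac_density \<nu> E))"
  have "(\<integral>\<^sup>+E. ennreal (max 0 (?l E)) \<partial>arcsine_law)
      = (\<integral>\<^sup>+E. ennreal (indicator {-2<..<2} E / (pi * sqrt (4 - E\<^sup>2))) * ennreal (max 0 (?l E)) \<partial>lborel)"
    unfolding arcsine_law_eq_density by (rule nn_integral_density) measurable
  also have "\<dots> \<le> I"
    unfolding I_def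
  proof (rule nn_integral_mono_AE)
    show "AE E in lborel. ennreal (indicator {-2<..<2} E / (pi * sqrt (4 - E\<^sup>2))) * ennreal (max 0 (?l E))
      \<le> e2ennreal (szego_integrand \<nu> E) * indicator {-2<..<2} E"
      using pos
    proof eventually_elim
      case (elim E)
      show ?case
      proof (cases "E \<in> {-2<..<2}")
        case True
        then have "E\<^sup>2 < 4" using abs_square_less_1[of "E / 2"] by (auto simp: power_divide)
        then have R: "sqrt (4 - E\<^sup>2) > 0" by simp
        have "ennreal (indicator {-2<..<2} E / (pi * sqrt (4 - E\<^sup>2))) * ennreal (max 0 (?l E))
            = ennreal (max 0 (?l E) / (pi * sqrt (4 - E\<^sup>2)))"
          using True R by (simp flip: ennreal_mult')
        \<comment> \<open>The arcsine density has an extra factor \<open>1 / pi\<close> compared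
          with the Szego integrand; dropping it only enlarges the value.\<close>
        also have "\<dots> \<le> ennreal (max 0 (?l E) / (1 * sqrt (4 - E\<^sup>2)))"
          using R pi_ge_two by (intro ennreal_leI frac_le mult_right_mono) auto
        also have "\<dots> = ennreal (?l E / sqrt (4 - E\<^sup>2))"
          using R by (cases "?l E \<ge> 0") (auto simp: max_def ennreal_neg divide_nonpos_pos)
        finally show ?thesis
          using True elim by (simp add: szego_integrand_def)
      qed simp
    qed
  qed
  finally have "(\<integral>\<^sup>+E. ennreal (max 0 (?l E)) \<partial>arcsine_law) < \<infinity>"
    using I by (simp add: less_top)
  then show "integrable arcsine_law (\<lambda>E. max 0 (?l E))"
    by (intro integrableI_nonneg) auto
qed

text \<open>Jensen's inequality for the weight \<open>(2 + s E)\<^sup>2 / 8\<close>, in the form \<open>ln y \<le> y - 1\<close>.\<close>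

lemma sum_integral_ln_le:
  assumes fin: "finite_measure \<nu>" and sets: "sets \<nu> = sets borel"
    and Z: "szego_integral \<nu> \<noteq> \<infinity>" and s: "s \<in> {1, -1}"
  shows "\<exists>K. \<forall>n (x :: nat \<Rightarrow> real) c. c > 0 \<longrightarrow>
      (\<integral>\<^sup>+E. ennreal ((\<Prod>j<n. E - x j)\<^sup>2) \<partial>\<nu>) = ennreal c \<longrightarrow>
      2 * (\<Sum>j<n. LINT E|arcsine_law. (2 + s * E)\<^sup>2 / 8 * ln \<bar>E - x j\<bar>) \<le> 3 / 4 * ln c + K"
proof -
  interpret finite_measure arcsine_law by (rule finite_measure_arcsine_law)
  define \<phi> where "\<phi> = (\<lambda>E. max 0 (ln (sqrt (4 - E\<^sup>2) / (2 * pi * ac_density \<nu> E))))"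
  \<comment> \<open>On (-2, 2) this is \<open>ln (4 / (4 - E^2)) \<ge> 0\<close>, written as a
    combination of potentials known to be integrable.\<close>
  define \<kappa> where "\<kappa> = (\<lambda>E::real. ln 4 - (ln \<bar>E - 2\<bar>) - (ln \<bar>E - (- 2)\<bar>))"
  define \<rho> where "\<rho> = (\<lambda>E. (2 + s * E)\<^sup>2 / 8)"
  have \<phi>: "integrable arcsine_law \<phi>"
    unfolding \<phi>_def by (rule integrable_szego_positive_part[OF fin sets Z])
  have \<kappa>: "integrable arcsine_law \<kappa>"
    unfolding \<kappa>_def
    by (intro Bochner_Integration.integrable_diff integrable_arcsine_law_ln integrable_const)
  have \<rho>: "integrable arcsine_law \<rho>" "(LINT E|arcsine_law. \<rho> E) = 3 / 4"
    unfolding \<rho>_def using s by (rule integrable_arcsine_law_weight, rule integral_arcsine_law_weight)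
  have inside: "AE E in arcsine_law. E \<in> {-2<..<2}"
    unfolding arcsine_law_eq_density by (subst AE_density) (auto split: split_indicator)
  have \<rho>_bound: "0 \<le> \<rho> E" "\<rho> E \<le> 2" if "E \<in> {-2<..<2}" for E
  proof -
    have "\<bar>2 + s * E\<bar> \<le> 4" using that s by auto
    then have "\<bar>2 + s * E\<bar>\<^sup>2 \<le> 4\<^sup>2" by (intro power_mono) auto
    then show "0 \<le> \<rho> E" "\<rho> E \<le> 2" unfolding \<rho>_def by auto
  qed
  show ?thesis
  proof (intro exI allI impI)
    fix n and x :: "nat \<Rightarrow> real" and c :: real
    assume c: "c > 0" and mass: "(\<integral>\<^sup>+E. ennreal ((\<Prod>j<n. E - x j)\<^sup>2) \<partial>\<nu>) = ennreal c"
    define p where "p = (\<lambda>E. (\<Prod>j<n. E - x j)\<^sup>2)"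
    \<comment> \<open>\<open>p\<close> times the density of the absolutely continuous part of \<nu>
      relative to the arcsine law; its integral is therefore at most \<open>c\<close>.\<close>
    define \<Psi> where "\<Psi> = (\<lambda>E. p E * ac_density \<nu> E * (pi * sqrt (4 - E\<^sup>2)))"
    have [measurable]: "p \<in> borel_measurable borel" "\<Psi> \<in> borel_measurable borel"
      unfolding p_def \<Psi>_def by measurable
    have p0: "p E \<ge> 0" for E by (simp add: p_def)
    have "(\<integral>\<^sup>+E. ennreal (\<Psi> E) \<partial>arcsine_law)
        = (\<integral>\<^sup>+E. ennreal (indicator {-2<..<2} E / (pi * sqrt (4 - E\<^sup>2))) * ennreal (\<Psi> E) \<partial>lborel)"
      unfolding arcsine_law_eq_density by (rule nn_integral_density) measurable
    also have "\<dots> \<le> (\<integral>\<^sup>+E. ennreal (p E) * ennreal (ac_density \<nu> E) \<partial>lborel)"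
    proof (rule nn_integral_mono)
      fix E :: real
      show "ennreal (indicator {-2<..<2} E / (pi * sqrt (4 - E\<^sup>2))) * ennreal (\<Psi> E)
          \<le> ennreal (p E) * ennreal (ac_density \<nu> E)"
      proof (cases "E \<in> {-2<..<2}")
        case True
        then have "E\<^sup>2 < 4" using abs_square_less_1[of "E / 2"] by (auto simp: power_divide)
        then have R: "sqrt (4 - E\<^sup>2) > 0" by simp
        then show ?thesis
          using True p0[of E] ac_density_nonneg[of \<nu> E]
          by (simp add: \<Psi>_def flip: ennreal_mult' ennreal_mult)
      qed simp
    qed
    also have "\<dots> \<le> (\<integral>\<^sup>+E. ennreal (p E) \<partial>\<nu>)"
      using fin sets by (intro nn_integral_ac_density_le) auto
    also have "\<dots> = ennreal c" unfolding p_def by (rule mass)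
    finally have \<Psi>_le: "(\<integral>\<^sup>+E. ennreal (\<Psi> E) \<partial>arcsine_law) \<le> ennreal c" .
    have \<Psi>_nonneg: "AE E in arcsine_law. \<Psi> E \<ge> 0"
      using inside
    proof eventually_elim
      case (elim E)
      then have "E\<^sup>2 < 4" using abs_square_less_1[of "E / 2"] by (auto simp: power_divide)
      then show ?case unfolding \<Psi>_def using p0[of E] ac_density_nonneg[of \<nu> E] by simp
    qed
    have \<Psi>: "integrable arcsine_law \<Psi>"
      using \<Psi>_le \<Psi>_nonneg by (intro integrableI_nonneg) (auto intro: le_less_trans)
    have "ennreal (LINT E|arcsine_law. \<Psi> E) \<le> ennreal c"
      using \<Psi>_le nn_integral_eq_integral[OF \<Psi> \<Psi>_nonneg] by simp
    then have \<Psi>_int: "(LINT E|arcsine_law. \<Psi> E) \<le> c" using c by simp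
    define F where "F = (\<lambda>E. \<Sum>j<n. 2 * (\<rho> E * ln \<bar>E - x j\<bar>))"
    \<comment> \<open>A majorant of \<open>F\<close>, which is \<open>\<rho> ln p\<close> almost
      everywhere; the factors 2 come from \<open>\<rho> E \<le> 2\<close>.\<close>
    define G where "G = (\<lambda>E. \<Psi> E / c + ((ln c - 1) * \<rho> E + (2 * \<phi> E + 2 * \<kappa> E)))"
    have ln_int: "integrable arcsine_law (\<lambda>E. \<rho> E * ln \<bar>E - x j\<bar>)" for j
      unfolding \<rho>_def using s by (rule integrable_arcsine_law_weight_ln)
    have F: "integrable arcsine_law F" "(LINT E|arcsine_law. F E)
        = 2 * (\<Sum>j<n. LINT E|arcsine_law. \<rho> E * ln \<bar>E - x j\<bar>)"
      unfolding F_def using ln_int by (simp_all add: sum_distrib_left)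
    have G: "integrable arcsine_law G"
      unfolding G_def using \<Psi> \<rho> \<phi> \<kappa>
      by (intro Bochner_Integration.integrable_add integrable_mult_right integrable_divide) auto
    have G_int: "(LINT E|arcsine_law. G E) = (LINT E|arcsine_law. \<Psi> E) / c + ((ln c - 1) * (3 / 4)
        + (2 * (LINT E|arcsine_law. \<phi> E) + 2 * (LINT E|arcsine_law. \<kappa> E)))"
      unfolding G_def \<rho>(2)[symmetric] using \<Psi> \<rho>(1) \<phi> \<kappa> by simp
    have ne: "AE E in arcsine_law. \<forall>j<n. E \<noteq> x j"
    proof -
      have "AE E in lborel. E \<notin> x ` {..<n}"
        by (intro AE_not_in finite_imp_null_set_lborel) simp
      then show ?thesis unfolding arcsine_law_eq_density
        by (subst AE_density) (auto elim!: eventually_mono)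
    qed
    have "AE E in arcsine_law. F E \<le> G E"
      using inside ne AE_ac_density_pos[OF fin sets Z]
    proof eventually_elim
      case (elim E)
      define R where "R = sqrt (4 - E\<^sup>2)"
      define w where "w = ac_density \<nu> E"
      have "E\<^sup>2 < 4" using elim(1) abs_square_less_1[of "E / 2"] by (auto simp: power_divide)
      then have R: "R > 0" "R\<^sup>2 = 4 - E\<^sup>2" by (simp_all add: R_def)
      have w: "w > 0" using elim(3) by (simp add: w_def)
      have p: "p E > 0" using elim(2) by (simp add: p_def)
      have \<Psi>E: "\<Psi> E = p E * w * (pi * R)" by (simp add: \<Psi>_def w_def R_def)
      have \<kappa>E: "\<kappa> E = 2 * ln 2 - 2 * ln R"
      proof -
        have "\<kappa> E = ln 4 - (ln (2 - E) + ln (2 + E))"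
          using elim(1) by (simp add: \<kappa>_def abs_minus_commute[of E 2] add.commute)
        also have "ln (2 - E) + ln (2 + E) = ln ((2 - E) * (2 + E))"
          using elim(1) by (simp add: ln_mult)
        also have "(2 - E) * (2 + E) = R\<^sup>2"
          unfolding R(2) by (simp add: algebra_simps power2_eq_square)
        also have "ln (R\<^sup>2) = 2 * ln R" using R(1) by (simp add: ln_realpow)
        also have "ln 4 = 2 * ln (2::real)" using ln_realpow[of 2 2] by simp
        finally show ?thesis .
      qed
      have "\<rho> E * ln (p E) = F E"
      proof -
        have "p E = (\<Prod>j<n. \<bar>E - x j\<bar>)\<^sup>2" by (simp add: p_def flip: abs_prod)
        also have "ln \<dots> = 2 * ln (\<Prod>j<n. \<bar>E - x j\<bar>)"
          using elim(2) by (subst ln_realpow) (auto intro!: prod_pos)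
        also have "ln (\<Prod>j<n. \<bar>E - x j\<bar>) = (\<Sum>j<n. ln \<bar>E - x j\<bar>)"
          using elim(2) by (intro ln_prod) auto
        finally show ?thesis by (simp add: F_def sum_distrib_left mult.left_commute)
      qed
      \<comment> \<open>Splits \<open>p\<close> into a normalised part for Jensen, the constant
        \<open>c\<close>, the Szego logarithm and an edge term. The 2 in \<open>2 * c\<close> is
        chosen so that \<open>\<rho> E \<le> 2\<close> gives exactly \<open>\<Psi> E / c\<close>
        next.\<close>
      moreover have "ln (p E) = ln (\<Psi> E / (2 * c)) + ln c + ln (R / (2 * pi * w)) + \<kappa> E"
      proof -
        show ?thesis
          unfolding \<Psi>E \<kappa>E using R w p c by (simp add: ln_mult ln_div)
      qed
      moreover have "\<rho> E * ln (\<Psi> E / (2 * c)) \<le> \<Psi> E / c - \<rho> E"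
      proof -
        have "\<Psi> E / (2 * c) > 0" unfolding \<Psi>E using R w p c by simp
        then have "\<rho> E * ln (\<Psi> E / (2 * c)) \<le> \<rho> E * (\<Psi> E / (2 * c) - 1)"
          using \<rho>_bound[OF elim(1)] by (intro mult_left_mono ln_le_minus_one) auto
        also have "\<rho> E * (\<Psi> E / (2 * c)) \<le> 2 * (\<Psi> E / (2 * c))"
          using \<rho>_bound[OF elim(1)] \<open>\<Psi> E / (2 * c) > 0\<close> by (intro mult_right_mono) auto
        then have "\<rho> E * (\<Psi> E / (2 * c) - 1) \<le> \<Psi> E / c - \<rho> E"
          by (simp add: algebra_simps)
        finally show ?thesis .
      qed
      moreover have "\<rho> E * ln (R / (2 * pi * w)) \<le> 2 * \<phi> E"
      proof -
        have "\<rho> E * ln (R / (2 * pi * w)) \<le> \<rho> E * \<phi> E"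
          using \<rho>_bound[OF elim(1)] by (intro mult_left_mono) (auto simp: \<phi>_def R_def w_def)
        also have "\<dots> \<le> 2 * \<phi> E"
          using \<rho>_bound[OF elim(1)] by (intro mult_right_mono) (auto simp: \<phi>_def)
        finally show ?thesis .
      qed
      moreover have "\<rho> E * \<kappa> E \<le> 2 * \<kappa> E"
      proof (rule mult_right_mono)
        have "R \<le> 2" by (rule power2_le_imp_le) (simp_all add: R(2))
        then show "0 \<le> \<kappa> E" unfolding \<kappa>E using R(1) by simp
      qed (rule \<rho>_bound[OF elim(1)])
      ultimately have "F E \<le> (\<Psi> E / c - \<rho> E) + \<rho> E * ln c + 2 * \<phi> E + 2 * \<kappa> E"
        by (smt (verit) distrib_left)
      then show ?case by (simp add: G_def algebra_simps)
    qed
    then have "(LINT E|arcsine_law. F E) \<le> (LINT E|arcsine_law. G E)"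
      using F(1) G by (intro integral_mono_AE)
    also have "\<dots> \<le> 1 + ((ln c - 1) * (3 / 4)
        + (2 * (LINT E|arcsine_law. \<phi> E) + 2 * (LINT E|arcsine_law. \<kappa> E)))"
      unfolding G_int using \<Psi>_int c by (intro add_right_mono) simp
    \<comment> \<open>The integral of \<open>\<Psi> / c\<close> is at most 1 and the weight has mass
      \<open>3/4\<close>, which leaves \<open>1/4\<close>. The constant depends on none of
      \<open>n\<close>, \<open>x\<close> and \<open>c\<close>.\<close>
    finally show "2 * (\<Sum>j<n. LINT E|arcsine_law. (2 + s * E)\<^sup>2 / 8 * ln \<bar>E - x j\<bar>) \<le> 3 / 4 * ln c
        + (1 / 4 + (2 * (LINT E|arcsine_law. \<phi> E) + 2 * (LINT E|arcsine_law. \<kappa> E)))"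
      unfolding F(2) \<rho>_def left_diff_distrib by linarith
  qed
qed

section \<open>Bound for the partial sums and conclusion\<close>

lemma partial_sums_bounded_below:
  fixes a b :: "nat \<Rightarrow> real"
  assumes a_pos: "\<And>n. n \<ge> 1 \<Longrightarrow> a n > 0"
    and jacobi: "is_jacobi_operator a b J"
    and spectral: "is_spectral_measure J (ell2_delta 1) \<nu>"
    and a_sum: "summable (\<lambda>n. (a (Suc n) - 1)\<^sup>2)"
    and b_sum: "summable (\<lambda>n. (b (Suc n))\<^sup>2)"
    and Z: "szego_integral \<nu> \<noteq> \<infinity>" and s: "s \<in> {1, -1}"
  shows "\<exists>B. \<forall>n. - (\<Sum>j=1..n. a j - 1 + s * b j / 2) \<le> B"
proof -
  have fin: "finite_measure \<nu>" and sets: "sets \<nu> = sets borel"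
    using spectral unfolding is_spectral_measure_def by auto
  obtain K where K: "\<forall>n (x :: nat \<Rightarrow> real) c. c > 0 \<longrightarrow>
      (\<integral>\<^sup>+E. ennreal ((\<Prod>j<n. E - x j)\<^sup>2) \<partial>\<nu>) = ennreal c \<longrightarrow>
      2 * (\<Sum>j<n. LINT E|arcsine_law. (2 + s * E)\<^sup>2 / 8 * ln \<bar>E - x j\<bar>) \<le> 3 / 4 * ln c + K"
    using sum_integral_ln_le[OF fin sets Z s] by (rule exE)
  define Sa Sb where "Sa = (\<Sum>n. (a (Suc n) - 1)\<^sup>2)" and "Sb = (\<Sum>n. (b (Suc n))\<^sup>2)"
  show ?thesis
  proof (intro exI allI)
    fix n
    obtain x where x: "jacobi_poly a b n = (\<Prod>j<n. [:- x j, 1:])"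
      "(\<Sum>j<n. x j) = (\<Sum>j=1..n. b j)"
      "(\<Sum>j<n. (x j)\<^sup>2) = (\<Sum>j=1..n. (b j)\<^sup>2 + 2 * (if j < n then (a j)\<^sup>2 else 0))"
      by (rule jacobi_poly_factorization)
    define A where "A = (\<Prod>j=1..n. a j)"
    have A: "A > 0" unfolding A_def using a_pos by (intro prod_pos) auto
    have "a j \<noteq> 0" if "j \<in> {1..n}" for j using a_pos[of j] that by auto
    then have "ln A = (\<Sum>j=1..n. ln (a j))" unfolding A_def by (intro ln_prod) auto
    then have lnA: "ln (A\<^sup>2) = 2 * (\<Sum>j=1..n. ln (a j))" using A by (simp add: ln_realpow)
    have "poly (jacobi_poly a b n) E = (\<Prod>j<n. E - x j)" for E
      unfolding x(1) poly_prod by (intro prod.cong) auto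
    then have "(\<integral>\<^sup>+E. ennreal ((\<Prod>j<n. E - x j)\<^sup>2) \<partial>\<nu>) = ennreal (A\<^sup>2)"
      using nn_integral_jacobi_poly_square[OF jacobi spectral a_pos, of n] by (simp add: A_def)
    \<comment> \<open>Jensen's bound with \<open>c = A^2\<close>, where \<open>x\<close> are the
      roots of the orthogonal polynomial.\<close>
    then have "2 * (\<Sum>j<n. LINT E|arcsine_law. (2 + s * E)\<^sup>2 / 8 * ln \<bar>E - x j\<bar>)
        \<le> 3 / 4 * ln (A\<^sup>2) + K"
      using A by (intro K[rule_format]) auto
    moreover have "(\<Sum>j<n. - s * x j / 2 - ((x j)\<^sup>2 - 2) / 16)
        \<le> (\<Sum>j<n. LINT E|arcsine_law. (2 + s * E)\<^sup>2 / 8 * ln \<bar>E - x j\<bar>)"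
      using s by (intro sum_mono integral_arcsine_law_weight_ln_ge)
    moreover have "(\<Sum>j<n. - s * x j / 2 - ((x j)\<^sup>2 - 2) / 16)
        = - (s * (\<Sum>j=1..n. b j)) / 2 - (\<Sum>j<n. (x j)\<^sup>2) / 16 + real n / 8"
      unfolding x(2)[symmetric]
      by (simp add: sum_subtractf sum_negf sum_divide_distrib[symmetric] sum_distrib_left[symmetric]
          diff_divide_distrib)
    \<comment> \<open>Adding the missing \<open>2 * (a n)^2\<close> makes the sum uniform in
      \<open>j\<close>; it enters the lower bound with a negative sign, so the estimate
      survives.\<close>
    moreover have "(\<Sum>j<n. (x j)\<^sup>2) \<le> (\<Sum>j=1..n. (b j)\<^sup>2 + 2 * (a j)\<^sup>2)"
      unfolding x(3) by (intro sum_mono) auto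
    ultimately have 1: "- (s * (\<Sum>j=1..n. b j)) - (\<Sum>j=1..n. (b j)\<^sup>2 + 2 * (a j)\<^sup>2) / 8 + real n / 4
        \<le> 3 / 2 * (\<Sum>j=1..n. ln (a j)) + K"
      unfolding lnA by linarith
    have 2: "3 / 2 * (\<Sum>j=1..n. ln (a j)) + s * (\<Sum>j=1..n. b j)
        + (\<Sum>j=1..n. (b j)\<^sup>2 + 2 * (a j)\<^sup>2) / 8 - real n / 4
      = (\<Sum>j=1..n. 3 / 2 * ln (a j) + s * b j + ((b j)\<^sup>2 + 2 * (a j)\<^sup>2) / 8 - 1 / 4)"
      by (simp add: sum.distrib sum_subtractf sum_distrib_left sum_divide_distrib add_divide_distrib)
    from 1 have "- K \<le> (\<Sum>j=1..n. 3 / 2 * ln (a j) + s * b j + ((b j)\<^sup>2 + 2 * (a j)\<^sup>2) / 8 - 1 / 4)"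
      unfolding 2[symmetric] by linarith
    also have "\<dots> \<le> (\<Sum>j=1..n. 2 * (a j - 1 + s * b j / 2) + ((b j)\<^sup>2 / 8 + (a j - 1)\<^sup>2 / 4))"
    proof (rule sum_mono)
      fix j assume "j \<in> {1..n}"
      then have "ln (a j) \<le> a j - 1" using a_pos by (intro ln_le_minus_one) auto
      \<comment> \<open>By \<open>a^2 - 1 = (a - 1)^2 + 2 * (a - 1)\<close> the quadratic term
        raises the coefficient of \<open>a - 1\<close> from \<open>3/2\<close> to 2 and leaves a
        summable remainder.\<close>
      then show "3 / 2 * ln (a j) + s * b j + ((b j)\<^sup>2 + 2 * (a j)\<^sup>2) / 8 - 1 / 4
          \<le> 2 * (a j - 1 + s * b j / 2) + ((b j)\<^sup>2 / 8 + (a j - 1)\<^sup>2 / 4)"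
        by (simp add: power2_eq_square field_simps)
    qed
    also have "\<dots> = 2 * (\<Sum>j=1..n. a j - 1 + s * b j / 2)
        + ((\<Sum>j=1..n. (b j)\<^sup>2) / 8 + (\<Sum>j=1..n. (a j - 1)\<^sup>2) / 4)"
      by (simp add: sum.distrib sum_distrib_left sum_divide_distrib)
    finally have "- K \<le> 2 * (\<Sum>j=1..n. a j - 1 + s * b j / 2)
        + ((\<Sum>j=1..n. (b j)\<^sup>2) / 8 + (\<Sum>j=1..n. (a j - 1)\<^sup>2) / 4)" .
    \<comment> \<open>Square summability enters here and makes the bound uniform in
      \<open>n\<close>.\<close>
    moreover have "(\<Sum>j=1..n. (b j)\<^sup>2) \<le> Sb" "(\<Sum>j=1..n. (a j - 1)\<^sup>2) \<le> Sa"
      unfolding Sa_def Sb_def One_nat_def sum.atLeast1_atMost_eq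
      using a_sum b_sum by (auto intro!: sum_le_suminf)
    moreover have "- t \<le> (K + Sb / 8 + Sa / 4) / 2"
      if "- K \<le> 2 * t + (u / 8 + v / 4)" "u \<le> Sb" "v \<le> Sa" for t u v :: real
      using that by (simp add: field_simps)
    ultimately show "- (\<Sum>j=1..n. a j - 1 + s * b j / 2) \<le> (K + Sb / 8 + Sa / 4) / 2"
      by blast
  qed
qed

theorem theorem4:
  fixes a b :: "nat \<Rightarrow> real" and J :: "ell2 \<Rightarrow>\<^sub>L ell2" and \<nu> :: "real measure"
  assumes a_pos: "\<And>n. n \<ge> 1 \<Longrightarrow> a n > 0"
    and jacobi: "is_jacobi_operator a b J"
    and spectral: "is_spectral_measure J (ell2_delta 1) \<nu>"
    and a_sum: "summable (\<lambda>n. (a (Suc n) - 1)\<^sup>2)"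
    and b_sum: "summable (\<lambda>n. (b (Suc n))\<^sup>2)"
    and limsup_inf:
      "limsup (\<lambda>n. ereal (- (\<Sum>j=1..n. a j - 1 + b j / 2))) = \<infinity> \<or>
       limsup (\<lambda>n. ereal (- (\<Sum>j=1..n. a j - 1 - b j / 2))) = \<infinity>"
  shows "szego_integral \<nu> = \<infinity>"
proof (rule ccontr)
  assume Z: "szego_integral \<nu> \<noteq> \<infinity>"
  \<comment> \<open>Both signs are excluded at once: a uniform bound for the partial sums bounds the
    limit superior.\<close>
  have "limsup (\<lambda>n. ereal (- (\<Sum>j=1..n. a j - 1 + s * b j / 2))) \<noteq> \<infinity>" if s: "s \<in> {1, -1}" for s
  proof -
    obtain B where B: "\<forall>n. - (\<Sum>j=1..n. a j - 1 + s * b j / 2) \<le> B"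
      using partial_sums_bounded_below[OF a_pos jacobi spectral a_sum b_sum Z s] by blast
    have "limsup (\<lambda>n. ereal (- (\<Sum>j=1..n. a j - 1 + s * b j / 2))) \<le> ereal B"
      using B by (intro Limsup_bounded always_eventually) (simp only: ereal_less_eq, blast)
    then show ?thesis by auto
  qed
  from this[of 1] this[of "-1"] show False using limsup_inf by simp
qed

end
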